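(* Let $p=1/2$. Then \[ \lim_{N\to\infty}\frac{1}{\sqrt N}\,\mathbb E\log X_N=\frac{2\pi}{3\sqrt 3}. \]
   Context: Let $p\in[0,1]$. For $N\ge 1$ let $\mathcal T$ be the full binary tree of depth $N$, where depth is counted so that the tree of depth $1$ is a single vertex (which is both root and leaf) and the root of the tree of depth $N+1$ has two children, each the root of a full binary tree of depth $N$. Let $\{\eta_v\}_{v\in\mathcal T}$ be independent random variables with $\mathbb P(\eta_v=1)=1-\mathbb P(\eta_v=-1)=p$. Define $X_v$ recursively from the leaves: $X_v=1$ if $v$ is a leaf; if $w$ has children $v_1,v_2$, then $X_w=X_{v_1}+X_{v_2}$ if $\eta_w=1$ and $X_w=\min(X_{v_1},X_{v_2})$ if $\eta_w=-1$. Set $X_N:=X_{root}$. Here $\log$ is the natural logarithm. *)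

theory Defs
  imports "HOL-Probability.Probability"
begin

text \<open>A vertex of the full binary tree of depth \<open>N\<close> is encoded by the sequence of left/right
  choices leading to it from the root \<open>[]\<close>, so the children of \<open>v\<close> are \<open>v @ [False]\<close> and
  \<open>v @ [True]\<close>. Depth counts vertices, not edges: leaves are the sequences of length \<open>N - 1\<close>.\<close>

definition tree_vertices :: "nat \<Rightarrow> bool list set"
  where "tree_vertices N = {v. length v < N}"

definition is_leaf :: "nat \<Rightarrow> bool list \<Rightarrow> bool"
  where "is_leaf N v \<longleftrightarrow> Suc (length v) = N"

text \<open>The test \<open>Suc (length v) \<ge> N\<close> also covers sequences outside the tree, where the value
  \<open>1\<close> is an irrelevant default that makes the recursion total.\<close>

function node_value :: "nat \<Rightarrow> (bool list \<Rightarrow> int) \<Rightarrow> bool list \<Rightarrow> nat"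
  where "node_value N s v =
    (if Suc (length v) \<ge> N then 1
     else if s v = 1 then node_value N s (v @ [False]) + node_value N s (v @ [True])
     else min (node_value N s (v @ [False])) (node_value N s (v @ [True])))"
  by pat_completeness auto
termination
  by (relation "Wellfounded.measure (\<lambda>(N, s, v). N - length v)") auto

declare node_value.simps [simp del]

lemma node_value_leaf: "is_leaf N v \<Longrightarrow> node_value N s v = 1"
  by (simp add: is_leaf_def node_value.simps)

lemma node_value_inner_plus:
  assumes "v \<in> tree_vertices N" "\<not> is_leaf N v" "s v = 1"
  shows "node_value N s v = node_value N s (v @ [False]) + node_value N s (v @ [True])"
  using assms by (subst node_value.simps) (auto simp: is_leaf_def tree_vertices_def)

lemma node_value_inner_min:
  assumes "v \<in> tree_vertices N" "\<not> is_leaf N v" "s v = -1"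
  shows "node_value N s v = min (node_value N s (v @ [False])) (node_value N s (v @ [True]))"
  using assms by (subst node_value.simps) (auto simp: is_leaf_def tree_vertices_def)

definition root_value :: "nat \<Rightarrow> (bool list \<Rightarrow> int) \<Rightarrow> nat"
  where "root_value N s = node_value N s []"

locale random_tree_signs = prob_space M
  for M :: "'a measure" and p :: real and N :: nat and \<eta> :: "bool list \<Rightarrow> 'a \<Rightarrow> int" +
  assumes indep: "indep_vars (\<lambda>_. count_space UNIV) \<eta> (tree_vertices N)"
    and prob_plus: "v \<in> tree_vertices N \<Longrightarrow> prob {\<omega> \<in> space M. \<eta> v \<omega> = 1} = p"
    and prob_minus: "v \<in> tree_vertices N \<Longrightarrow> prob {\<omega> \<in> space M. \<eta> v \<omega> = -1} = 1 - p"

end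

theory Submission
  imports Defs "HOL-Real_Asymp.Real_Asymp"
begin

text \<open>
  Let \<open>F\<close> be the distribution function of \<open>log X\<close> at some level. Since \<open>p = 1/2\<close>, the contributions of
  \<open>min\<close> and \<open>max\<close> cancel and the next distribution function is \<open>F - D / 2\<close>, where \<open>D x\<close> is the
  probability that two independent copies are both at most \<open>x\<close> while the logarithm of the sum of
  their exponentials exceeds \<open>x\<close>. For a slowly varying density \<open>\<rho>\<close> one has \<open>D \<approx> (\<pi>\<^sup>2 / 6) \<rho>\<^sup>2\<close>, the
  constant being the area of \<open>{s, t \<ge> 0. exp (- s) + exp (- t) > 1}\<close>. So \<open>F\<close> follows the
  Hamilton-Jacobi equation \<open>F\<^sub>t = - (\<pi>\<^sup>2 / 12) F\<^sub>x\<^sup>2\<close>, whose solution started from a point mass at \<open>0\<close> is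
  \<open>min 1 (x\<^sup>2 / (c\<^sup>2 t))\<close> with \<open>c\<^sup>2 = \<pi>\<^sup>2 / 3\<close>; the mean of this law is \<open>2 c \<surd>t / 3\<close>.

  The recursion is monotone in \<open>F\<close>, so explicit barriers give matching bounds. From below, \<open>F\<close>
  dominates a self-similar profile that is quadratic up to the fraction \<open>u0\<close> of the front and has an
  exponential tail beyond it, spreading slightly faster than the true solution. From above, \<open>F\<close> stays
  below the parabola \<open>(x + B)\<^sup>2 / (c\<^sup>2 (n + 1))\<close>, where the shift \<open>B\<close> absorbs the discretisation errors
  and grows only logarithmically in \<open>n\<close>.
\<close>

section \<open>The interaction kernel\<close>

text \<open>For \<open>s > 0\<close>, \<open>exp (- s) + exp (- t) > 1\<close> iff \<open>t < gap s\<close>.\<close>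

definition gap :: "real \<Rightarrow> real" where
  "gap s = - ln (1 - exp (- s))"

lemma exp_gap: "s > 0 \<Longrightarrow> exp (gap s) = 1 / (1 - exp (- s))"
  by (simp add: gap_def exp_minus inverse_eq_divide)

lemma gap_pos: "s > 0 \<Longrightarrow> gap s > 0"
  by (simp add: gap_def)

lemma continuous_on_gap [continuous_intros]: "continuous_on {0<..} gap"
  unfolding gap_def by (intro continuous_intros) auto

lemma exp_gap_le: "exp (gap s) \<le> (1 + s) / s" if "s > 0"
proof -
  have "exp (- s) \<le> 1 / (1 + s)"
    using exp_ge_add_one_self[of s] that by (simp add: exp_minus field_simps)
  then have "s / (1 + s) \<le> 1 - exp (- s)"
    using that by (simp add: field_simps)
  then have "1 / (1 - exp (- s)) \<le> 1 / (s / (1 + s))"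
    using that by (intro divide_left_mono) auto
  then show ?thesis using that by (simp add: exp_gap)
qed

text \<open>With t = gap s, the bound t <= exp t - 1 = exp (t - s) decays in s but is too singular
  at 0 once the weight is added, while t <= 2 * exp (t / 2) does not decay. Their geometric mean
  does both: exp (gap s) is of order 1 / s near 0, so the factor exp (7 / 8 * gap s) stays
  integrable there.\<close>

lemma gap_weight_bound:
  assumes "s > 0"
  shows "gap s * exp ((s + gap s) / 8) \<le> 2 * exp (7 / 8 * gap s) * exp (- (3 / 8) * s)"
proof -
  define t where "t = gap s"
  have t: "t > 0" using gap_pos[OF assms] by (simp add: t_def)
  have "t \<le> exp t - 1"
    using exp_ge_add_one_self[of t] by linarith
  also have "\<dots> = exp (t - s)"
    using assms by (simp add: t_def exp_gap exp_diff exp_minus field_simps)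
  finally have 1: "t \<le> exp (t - s)" .
  have 2: "t \<le> 2 * exp (t / 2)"
    using exp_ge_add_one_self[of "t / 2"] by linarith
  have "t\<^sup>2 \<le> exp (t - s) * (2 * exp (t / 2))"
    unfolding power2_eq_square using t by (intro mult_mono 1 2) auto
  also have "\<dots> = 2 * exp (3 / 2 * t - s)"
    by (simp add: exp_add[symmetric])
  also have "\<dots> \<le> 4 * exp (3 / 2 * t - s)"
    by simp
  also have "\<dots> = (2 * exp (3 / 4 * t - s / 2))\<^sup>2"
    by (simp add: power2_eq_square exp_add[symmetric])
  finally have "t \<le> 2 * exp (3 / 4 * t - s / 2)"
    by (rule power2_le_imp_le) simp
  then have "t * exp ((s + t) / 8) \<le> 2 * exp (3 / 4 * t - s / 2) * exp ((s + t) / 8)"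
    by (intro mult_right_mono) auto
  also have "\<dots> = 2 * exp (7 / 8 * t) * exp (- (3 / 8) * s)"
    by (simp add: exp_add[symmetric] field_simps)
  finally show ?thesis by (simp add: t_def)
qed

lemma integrable_dominated_continuous:
  fixes f g :: "real \<Rightarrow> real"
  assumes "continuous_on {0<..} f" "g integrable_on {0<..}" "\<And>s. s > 0 \<Longrightarrow> \<bar>f s\<bar> \<le> g s"
  shows "f integrable_on {0<..}"
proof (rule measurable_bounded_by_integrable_imp_integrable[OF _ assms(2)])
  show "f \<in> borel_measurable (lebesgue_on {0<..})"
    by (rule continuous_imp_measurable_on_sets_lebesgue[OF assms(1)]) simp
qed (simp_all add: assms(3))

text \<open>The common dominating function for all later integrals of \<open>gap\<close>. Near 0,
  exp (gap s) <= 2 / s leaves the power -7/8 of s; from 1 on, exp (gap s) <= 2 leaves an exponential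
  tail.\<close>

lemma gap_weight_integrable: "(\<lambda>s. gap s * exp ((s + gap s) / 8)) integrable_on {0<..}"
proof (rule integrable_dominated_continuous)
  define g :: "real \<Rightarrow> real" where "g = (\<lambda>s. if s < 1 then 4 * s powr (- (7 / 8)) else 4 * exp (- (3 / 8) * s))"
  have "(\<lambda>s::real. 4 * s powr (- (7 / 8))) integrable_on {0<..1}"
    using integrable_cmul[OF integrable_on_powr_from_0'[of "- (7 / 8)" 1], of 4] by simp
  then have "g integrable_on {0<..1}"
    by (rule integrable_spike_finite[of "{1}", rotated 2]) (auto simp: g_def)
  moreover have "(\<lambda>s::real. 4 * exp (- (3 / 8) * s)) integrable_on {1..}"
    using integrable_cmul[OF integrable_on_exp_minus_to_infinity[of "3 / 8" 1], of 4] by simp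
  then have "g integrable_on {1..}"
    by (rule integrable_spike_finite[of "{}", rotated 2]) (auto simp: g_def)
  ultimately show "g integrable_on {0<..}"
    by (rule integrable_Un') (auto intro: negligible_subset[OF negligible_finite[of "{1}"]])
  show "continuous_on {0<..} (\<lambda>s. gap s * exp ((s + gap s) / 8))"
    by (intro continuous_intros) auto
  show "\<bar>gap s * exp ((s + gap s) / 8)\<bar> \<le> g s" if s: "s > 0" for s
  proof -
    have e: "exp (7 / 8 * gap s) = exp (gap s) powr (7 / 8)"
      by (simp add: powr_def)
    have "\<bar>gap s * exp ((s + gap s) / 8)\<bar> \<le> 2 * exp (7 / 8 * gap s) * exp (- (3 / 8) * s)"
      using gap_weight_bound[OF s] gap_pos[OF s] by simp
    also have "\<dots> \<le> g s"
    proof (cases "s < 1")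
      case True
      have "exp (gap s) \<le> 2 / s"
        by (rule order_trans[OF exp_gap_le[OF s] divide_right_mono]) (use True s in linarith)+
      then have "exp (7 / 8 * gap s) \<le> (2 / s) powr (7 / 8)"
        unfolding e using s by (intro powr_mono2) auto
      also have "\<dots> = 2 powr (7 / 8) * s powr (- (7 / 8))"
        unfolding powr_minus_divide using s by (simp add: powr_divide)
      also have "\<dots> \<le> 2 powr 1 * s powr (- (7 / 8))"
        by (intro mult_right_mono powr_mono) auto
      finally have "exp (7 / 8 * gap s) * exp (- (3 / 8) * s) \<le> (2 * s powr (- (7 / 8))) * 1"
        using s by (intro mult_mono) auto
      then show ?thesis using True by (simp add: g_def mult_ac)
    next
      case False
      have "(1 + s) / s \<le> 2"
        using False by (simp add: field_simps)
      then have "exp (gap s) \<le> 2"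
        using exp_gap_le[OF s] by linarith
      then have "exp (7 / 8 * gap s) \<le> 2 powr (7 / 8)"
        unfolding e by (intro powr_mono2) auto
      also have "\<dots> \<le> 2 powr 1"
        by (intro powr_mono) auto
      finally have "exp (7 / 8 * gap s) * exp (- (3 / 8) * s) \<le> 2 * exp (- (3 / 8) * s)"
        by (intro mult_right_mono) auto
      then show ?thesis using False by (simp add: g_def mult_ac)
    qed
    finally show ?thesis .
  qed
qed

section \<open>The integral of \<open>gap\<close> and of its weighted versions\<close>

lemma gap_sums: "s > 0 \<Longrightarrow> (\<lambda>n. exp (- real (Suc n) * s) / real (Suc n)) sums gap s"
proof -
  assume "s > 0"
  then have "\<bar>- exp (- s)\<bar> < 1" by simp
  from ln_series'[OF this] have "(\<lambda>n. - (exp (- s) ^ n / real n)) sums ln (1 - exp (- s))"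
    by simp
  from sums_minus[OF this] have "(\<lambda>n. exp (- s) ^ n / real n) sums gap s"
    by (simp add: gap_def)
  then have "(\<lambda>n. exp (- s) ^ Suc n / real (Suc n)) sums gap s"
    by (subst sums_Suc_iff) simp
  moreover have "exp (- s) ^ Suc n = exp (- real (Suc n) * s)" for n
    by (subst exp_of_nat_mult[symmetric]) (simp add: algebra_simps)
  ultimately show ?thesis by simp
qed

text \<open>The logarithmic series integrated term by term gives the sum of 1 / n^2; monotone
  convergence applies because all terms are positive.\<close>

lemma gap_has_integral: "(gap has_integral pi\<^sup>2 / 6) {0<..}"
proof -
  define f where "f = (\<lambda>k s. \<Sum>n<k. exp (- real (Suc n) * s) / real (Suc n))"
  have e: "((\<lambda>s. exp (- real (Suc n) * s)) has_integral 1 / real (Suc n)) {0<..}" for n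
    using has_integral_exp_minus_to_infinity[of "real (Suc n)" 0]
    by (subst has_integral_spike_set_eq[where T = "{0..}"])
       (auto intro: negligible_subset[OF negligible_finite[of "{0}"]])
  have "(f k has_integral (\<Sum>n<k. 1 / (real (Suc n))\<^sup>2)) {0<..}" for k
  proof -
    have "((\<lambda>s. exp (- real (Suc n) * s) / real (Suc n)) has_integral 1 / (real (Suc n))\<^sup>2) {0<..}" for n
      using has_integral_divide[OF e[of n], of "real (Suc n)"] by (simp add: power2_eq_square)
    then show ?thesis unfolding f_def by (intro has_integral_sum) auto
  qed
  then have int: "f k integrable_on {0<..}" "integral {0<..} (f k) = (\<Sum>n<k. 1 / (real (Suc n))\<^sup>2)" for k
    by (auto simp: integrable_on_def integral_unique)
  have lim: "(\<lambda>k. integral {0<..} (f k)) \<longlonglongrightarrow> pi\<^sup>2 / 6"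
    using inverse_squares_sums unfolding int sums_def by (simp add: add.commute)
  have "gap integrable_on {0<..} \<and> ((\<lambda>k. integral {0<..} (f k)) \<longlonglongrightarrow> integral {0<..} gap)"
  proof (rule monotone_convergence_increasing[OF int(1)])
    show "f k s \<le> f (Suc k) s" for k s
      by (simp add: f_def)
    show "(\<lambda>k. f k s) \<longlonglongrightarrow> gap s" if "s \<in> {0<..}" for s
      using gap_sums[of s] that by (simp add: sums_def f_def)
    show "bounded (range (\<lambda>k. integral {0<..} (f k)))"
      using lim by (rule convergent_imp_bounded)
  qed
  then have "gap integrable_on {0<..}" "pi\<^sup>2 / 6 = integral {0<..} gap"
    using LIMSEQ_unique[OF lim] by blast+
  then show ?thesis
    by (simp add: has_integral_iff)
qed

lemma gap_moment_integrable:
  "(\<lambda>s. s * gap s + (gap s)\<^sup>2 / 2) integrable_on {0<..}"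
proof (rule integrable_dominated_continuous)
  show "continuous_on {0<..} (\<lambda>s. s * gap s + (gap s)\<^sup>2 / 2)"
    by (intro continuous_intros) auto
  show "(\<lambda>s. 8 * (gap s * exp ((s + gap s) / 8))) integrable_on {0<..}"
    using integrable_cmul[OF gap_weight_integrable, of 8] by simp
  show "\<bar>s * gap s + (gap s)\<^sup>2 / 2\<bar> \<le> 8 * (gap s * exp ((s + gap s) / 8))" if "s > 0" for s
  proof -
    have "s + gap s / 2 \<le> 8 * exp ((s + gap s) / 8)"
      using exp_ge_add_one_self[of "(s + gap s) / 8"] gap_pos[OF that] by argo
    then have "gap s * (s + gap s / 2) \<le> gap s * (8 * exp ((s + gap s) / 8))"
      using gap_pos[OF that] by (intro mult_left_mono) auto
    then show ?thesis
      using gap_pos[OF that] that by (simp add: algebra_simps power2_eq_square)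
  qed
qed

lemma gap_exp_integrable:
  assumes "0 \<le> \<gamma>" "\<gamma> \<le> 1 / 8"
  shows "(\<lambda>s. gap s * exp (\<gamma> * (s + gap s))) integrable_on {0<..}"
proof (rule integrable_dominated_continuous[OF _ gap_weight_integrable])
  show "continuous_on {0<..} (\<lambda>s. gap s * exp (\<gamma> * (s + gap s)))"
    by (intro continuous_intros)
  show "\<bar>gap s * exp (\<gamma> * (s + gap s))\<bar> \<le> gap s * exp ((s + gap s) / 8)" if "s > 0" for s
    using mult_right_mono[OF assms(2), of "s + gap s"] gap_pos[OF that] that
    by (simp add: abs_mult)
qed

text \<open>Dominated convergence as the exponential rate tends to 0. An exponential tail of small
  rate therefore costs arbitrarily little over the ideal constant pi^2 / 6.\<close>

lemma gap_exp_integral_near: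
  assumes "J > pi\<^sup>2 / 6"
  obtains \<gamma> where "0 < \<gamma>" "\<gamma> \<le> 1 / 8" "integral {0<..} (\<lambda>s. gap s * exp (\<gamma> * (s + gap s))) < J"
proof -
  define \<gamma> where "\<gamma> = (\<lambda>k::nat. 1 / (real k + 8))"
  have \<gamma>: "0 < \<gamma> k" "\<gamma> k \<le> 1 / 8" for k
    by (auto simp: \<gamma>_def field_simps)
  have lim: "\<gamma> \<longlonglongrightarrow> 0"
    unfolding \<gamma>_def by real_asymp
  have "(\<lambda>k. integral {0<..} (\<lambda>s. gap s * exp (\<gamma> k * (s + gap s)))) \<longlonglongrightarrow> integral {0<..} gap"
  proof (rule dominated_convergence(2)[OF _ gap_weight_integrable])
    show "(\<lambda>s. gap s * exp (\<gamma> k * (s + gap s))) integrable_on {0<..}" for k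
      using \<gamma>[of k] by (intro gap_exp_integrable) auto
    show "norm (gap s * exp (\<gamma> k * (s + gap s))) \<le> gap s * exp ((s + gap s) / 8)" if "s \<in> {0<..}" for s k
      using mult_right_mono[OF \<gamma>(2)[of k], of "s + gap s"] gap_pos[of s] that
      by (simp add: abs_mult)
    show "(\<lambda>k. gap s * exp (\<gamma> k * (s + gap s))) \<longlonglongrightarrow> gap s" if "s \<in> {0<..}" for s
      using tendsto_mult[OF tendsto_const[of "gap s"] tendsto_exp[OF tendsto_mult[OF lim tendsto_const[of "s + gap s"]]]]
      by simp
  qed
  then have "eventually (\<lambda>k. integral {0<..} (\<lambda>s. gap s * exp (\<gamma> k * (s + gap s))) < J) sequentially"
    using assms gap_has_integral by (intro order_tendstoD(2)) (auto simp: integral_unique)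
  then obtain k where "integral {0<..} (\<lambda>s. gap s * exp (\<gamma> k * (s + gap s))) < J"
    using eventually_happens by force
  with \<gamma>[of k] that show ?thesis by blast
qed

section \<open>The law of the root value\<close>

text \<open>\<open>mean n g\<close> is the expectation of \<open>g X\<close> for the root value \<open>X\<close> of the tree of depth \<open>n + 1\<close>.\<close>

primrec mean :: "nat \<Rightarrow> (nat \<Rightarrow> real) \<Rightarrow> real" where
  "mean 0 g = g 1"
| "mean (Suc n) g = (mean n (\<lambda>i. mean n (\<lambda>j. g (i + j))) + mean n (\<lambda>i. mean n (\<lambda>j. g (min i j)))) / 2"

definition mass :: "nat \<Rightarrow> nat \<Rightarrow> real" where
  "mass n k = mean n (\<lambda>i. of_bool (i = k))"

text \<open>The law at level n is carried by {1..2^n}: sums of two values at most double the upper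
  end and minima stay inside, so pointwise comparison there suffices.\<close>

lemma mean_mono:
  assumes "\<And>i. i \<in> {1..2 ^ n} \<Longrightarrow> f i \<le> g i"
  shows "mean n f \<le> mean n g"
  using assms
proof (induction n arbitrary: f g)
  case (Suc n)
  have "mean n (\<lambda>i. mean n (\<lambda>j. f (i + j))) \<le> mean n (\<lambda>i. mean n (\<lambda>j. g (i + j)))"
    by (intro Suc.IH Suc.prems) auto
  moreover have "mean n (\<lambda>i. mean n (\<lambda>j. f (min i j))) \<le> mean n (\<lambda>i. mean n (\<lambda>j. g (min i j)))"
    by (intro Suc.IH Suc.prems) (auto simp: min_def)
  ultimately show ?case by simp
qed simp

lemma mean_cong:
  assumes "\<And>i. i \<in> {1..2 ^ n} \<Longrightarrow> f i = g i"
  shows "mean n f = mean n g"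
  using assms by (intro antisym mean_mono) auto

lemma mean_add: "mean n (\<lambda>i. f i + g i) = mean n f + mean n g"
  by (induction n arbitrary: f g) (simp_all add: add_divide_distrib)

lemma mean_cmult: "mean n (\<lambda>i. c * f i) = c * mean n f"
  by (induction n arbitrary: f) (simp_all add: distrib_left)

lemma mean_const [simp]: "mean n (\<lambda>i. c) = c"
  by (induction n) simp_all

lemma mean_diff: "mean n (\<lambda>i. f i - g i) = mean n f - mean n g"
  using mean_add[of n f "\<lambda>i. - 1 * g i"] mean_cmult[of n "-1" g] by simp

lemma mean_sum: "finite A \<Longrightarrow> mean n (\<lambda>i. \<Sum>k\<in>A. f k i) = (\<Sum>k\<in>A. mean n (f k))"
  by (induction A rule: finite_induct) (simp_all add: mean_add)

lemma mean_nonneg: "(\<And>i. i \<in> {1..2 ^ n} \<Longrightarrow> 0 \<le> f i) \<Longrightarrow> 0 \<le> mean n f"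
  using mean_mono[of n "\<lambda>_. 0" f] by simp

text \<open>As a finite weighted sum, \<open>mean\<close> can be exchanged with integrals over the
  real line.\<close>

lemma mean_eq_sum: "mean n f = (\<Sum>k\<in>{1..2 ^ n}. mass n k * f k)"
proof -
  have "mean n f = mean n (\<lambda>i. \<Sum>k\<in>{1..2 ^ n}. f k * of_bool (i = k))"
  proof (rule mean_cong)
    fix i :: nat assume i: "i \<in> {1..2 ^ n}"
    have "(\<Sum>k\<in>{1..2 ^ n}. f k * of_bool (i = k)) = (\<Sum>k\<in>{1..2 ^ n}. if i = k then f k else 0)"
      by (intro sum.cong) auto
    then show "f i = (\<Sum>k\<in>{1..2 ^ n}. f k * of_bool (i = k))"
      using i by (simp only: sum.delta' finite_atLeastAtMost if_True)
  qed
  also have "\<dots> = (\<Sum>k\<in>{1..2 ^ n}. mass n k * f k)"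
    unfolding mean_sum[OF finite_atLeastAtMost] mean_cmult mass_def by (simp only: mult.commute)
  finally show ?thesis .
qed

section \<open>From random signs to the recursion for \<open>mean\<close>\<close>

lemma node_value_cong:
  assumes "\<And>w. length (v @ w) < N \<Longrightarrow> s (v @ w) = s' (v @ w)"
  shows "node_value N s v = node_value N s' v"
  using assms
proof (induction "N - length v" arbitrary: v rule: less_induct)
  case less
  show ?case
  proof (cases "Suc (length v) \<ge> N")
    case False
    have "s v = s' v"
      using less.prems[of "[]"] False by simp
    moreover have "node_value N s (v @ [b]) = node_value N s' (v @ [b])" for b
    proof (rule less.hyps)
      show "s ((v @ [b]) @ w) = s' ((v @ [b]) @ w)" if "length ((v @ [b]) @ w) < N" for w
        using less.prems[of "b # w"] that by simp
    qed (use False in simp)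
    ultimately show ?thesis
      by (simp add: node_value.simps[of N s v] node_value.simps[of N s' v])
  qed (simp add: node_value.simps)
qed

lemma node_value_bounds:
  assumes "N = Suc (length v + n)"
  shows "node_value N s v \<in> {1..2 ^ n}"
  using assms
proof (induction n arbitrary: v)
  case (Suc n)
  have "node_value N s (v @ [b]) \<in> {1..2 ^ n}" for b
    using Suc.prems by (intro Suc.IH) simp
  from this[of False] this[of True] show ?case
    by (subst node_value.simps) (auto simp: min_def)
qed (simp add: node_value.simps)

lemma measurable_count_space_combine:
  fixes h :: "'b::countable \<Rightarrow> 'c::countable \<Rightarrow> 'd"
  assumes "f \<in> measurable M (count_space UNIV)" "g \<in> measurable M (count_space UNIV)"
  shows "(\<lambda>x. h (f x) (g x)) \<in> measurable M (count_space UNIV)"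
proof -
  have "(\<lambda>x. (\<lambda>i x. (\<lambda>j x. h i j) (g x) x) (f x) x) \<in> measurable M (count_space UNIV)"
    by (rule measurable_compose_countable[OF measurable_compose_countable[OF _ assms(2)] assms(1)]) simp
  then show ?thesis by simp
qed

lemma measurable_node_value:
  assumes "\<And>w. length (v @ w) < N \<Longrightarrow> v @ w \<in> K"
  shows "(\<lambda>s. node_value N s v) \<in> measurable (PiM K (\<lambda>_. count_space UNIV)) (count_space UNIV)"
  using assms
proof (induction "N - length v" arbitrary: v rule: less_induct)
  case less
  show ?case
  proof (cases "Suc (length v) \<ge> N")
    case False
    have "v @ [] \<in> K"
      by (rule less.prems) (use False in simp)
    then have s: "(\<lambda>s. s v) \<in> measurable (PiM K (\<lambda>_. count_space UNIV)) (count_space UNIV)"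
      by (intro measurable_component_singleton) simp
    have c: "(\<lambda>s. node_value N s (v @ [b])) \<in> measurable (PiM K (\<lambda>_. count_space UNIV)) (count_space UNIV)" for b
    proof (rule less.hyps)
      show "(v @ [b]) @ w \<in> K" if "length ((v @ [b]) @ w) < N" for w
        using less.prems[of "b # w"] that by simp
    qed (use False in simp)
    note measurable_count_space_combine[OF s measurable_count_space_combine[OF c[of False] c[of True], of Pair],
      of "\<lambda>x (y, z). if x = 1 then y + z else min y z"]
    then show ?thesis
      using False by (subst node_value.simps) simp
  qed (simp add: node_value.simps)
qed

text \<open>Measurability of the signs is known only on the tree, so they are first restricted to
  \<open>tree_vertices N\<close>; by \<open>node_value_cong\<close> the value does not
  change.\<close>

lemma (in random_tree_signs) measurable_node:
  "(\<lambda>\<omega>. node_value N (\<lambda>u. \<eta> u \<omega>) v) \<in> measurable M (count_space UNIV)"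
proof (cases "length v < N")
  case True
  have "(\<lambda>\<omega>. \<lambda>u\<in>tree_vertices N. \<eta> u \<omega>) \<in> measurable M (PiM (tree_vertices N) (\<lambda>_. count_space UNIV))"
    using indep by (intro measurable_restrict) (auto simp: indep_vars_def)
  from measurable_compose[OF this measurable_node_value[of v N]]
  have "(\<lambda>\<omega>. node_value N (\<lambda>u\<in>tree_vertices N. \<eta> u \<omega>) v) \<in> measurable M (count_space UNIV)"
    by (simp add: tree_vertices_def)
  moreover have "node_value N (\<lambda>u\<in>tree_vertices N. \<eta> u \<omega>) v = node_value N (\<lambda>u. \<eta> u \<omega>) v" for \<omega>
    by (intro node_value_cong) (simp add: tree_vertices_def)
  ultimately show ?thesis by simp
qed (simp add: node_value.simps)

text \<open>The sign at v and the values at its two children depend on signs in three disjoint sets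
  of vertices: {v} and the two subtrees. Grouping independent variables along disjoint index sets
  keeps independence.\<close>

lemma (in random_tree_signs) node_indep:
  assumes v: "Suc (length v) < N"
  defines "A \<equiv> \<lambda>b \<omega>. node_value N (\<lambda>u. \<eta> u \<omega>) (v @ [b])"
  shows "prob {\<omega> \<in> space M. \<eta> v \<omega> = c \<and> A False \<omega> = i \<and> A True \<omega> = j} =
    prob {\<omega> \<in> space M. \<eta> v \<omega> = c} * prob {\<omega> \<in> space M. A False \<omega> = i} * prob {\<omega> \<in> space M. A True \<omega> = j}"
proof -
  define L :: "bool option set" where "L = UNIV"
  define K where "K = (\<lambda>l. case l of None \<Rightarrow> {v} | Some b \<Rightarrow> {u \<in> tree_vertices N. \<exists>w. u = (v @ [b]) @ w})"
  \<comment> \<open>The family needs one value type, so the sign enters only through the natural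
    number indicating whether it equals c.\<close>
  define Z where "Z = (\<lambda>l s. case l of None \<Rightarrow> of_bool (s v = c) | Some b \<Rightarrow> node_value N s (v @ [b]))"
  have KI: "K l \<subseteq> tree_vertices N" for l
    using v by (cases l) (auto simp: K_def tree_vertices_def)
  have disj: "disjoint_family_on K L"
  proof -
    have "K l \<inter> K l' = {}" if "l \<noteq> l'" for l l'
      using that by (cases l; cases l') (auto simp: K_def)
    then show ?thesis by (simp add: disjoint_family_on_def)
  qed
  have "Z l \<in> measurable (PiM (K l) (\<lambda>_. count_space UNIV)) (count_space UNIV)" for l
  proof (cases l)
    case None
    have "(\<lambda>s. of_bool (s v = c) :: nat) \<in> measurable (PiM {v} (\<lambda>_. count_space UNIV)) (count_space UNIV)"
      by (rule measurable_compose[OF measurable_component_singleton[of v]]) auto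
    then show ?thesis by (simp add: None Z_def K_def)
  next
    case (Some b)
    have "(\<lambda>s. node_value N s (v @ [b])) \<in> measurable (PiM (K l) (\<lambda>_. count_space UNIV)) (count_space UNIV)"
      by (intro measurable_node_value) (auto simp: Some K_def tree_vertices_def)
    then show ?thesis by (simp add: Some Z_def)
  qed
  then have ind: "indep_vars (\<lambda>_. count_space UNIV) (\<lambda>l \<omega>. Z l (restrict (\<lambda>u. \<eta> u \<omega>) (K l))) L"
    by (intro indep_vars_compose2[OF indep_vars_restrict[OF indep KI disj]])
  have Z: "Z None (restrict (\<lambda>u. \<eta> u \<omega>) (K None)) = of_bool (\<eta> v \<omega> = c)"
    "Z (Some b) (restrict (\<lambda>u. \<eta> u \<omega>) (K (Some b))) = A b \<omega>" for \<omega> b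
    by (auto simp: Z_def K_def A_def tree_vertices_def intro!: node_value_cong)
  let ?S = "\<lambda>l. case l of None \<Rightarrow> {1} | Some b \<Rightarrow> {if b then j else i}"
  have L: "L = {None, Some False, Some True}"
    using UNIV_option_conv by (auto simp: L_def UNIV_bool)
  have "prob (\<Inter>l\<in>L. (\<lambda>\<omega>. Z l (restrict (\<lambda>u. \<eta> u \<omega>) (K l))) -` ?S l \<inter> space M) =
    (\<Prod>l\<in>L. prob ((\<lambda>\<omega>. Z l (restrict (\<lambda>u. \<eta> u \<omega>) (K l))) -` ?S l \<inter> space M))"
    by (rule indep_varsD_finite[OF ind]) (auto simp: L)
  moreover have "(\<Inter>l\<in>L. (\<lambda>\<omega>. Z l (restrict (\<lambda>u. \<eta> u \<omega>) (K l))) -` ?S l \<inter> space M) =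
    {\<omega> \<in> space M. \<eta> v \<omega> = c \<and> A False \<omega> = i \<and> A True \<omega> = j}"
    unfolding L by (auto simp: Z of_bool_def split: if_splits)
  moreover have "(\<lambda>\<omega>. Z None (restrict (\<lambda>u. \<eta> u \<omega>) (K None))) -` ?S None \<inter> space M =
      {\<omega> \<in> space M. \<eta> v \<omega> = c}"
    by (auto simp: Z of_bool_def split: if_splits)
  moreover have A: "(\<lambda>\<omega>. Z (Some b) (restrict (\<lambda>u. \<eta> u \<omega>) (K (Some b)))) -` ?S (Some b) \<inter> space M =
      {\<omega> \<in> space M. A b \<omega> = (if b then j else i)}" for b
    by (auto simp: Z)
  ultimately show ?thesis
    using A[of False] A[of True] unfolding L by (simp add: mult.assoc)
qed

text \<open>Induction on the height of the subtree at v; p = 1/2 produces the equal weights in the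
  recursion for \<open>mean\<close>.\<close>

lemma (in random_tree_signs) expectation_node:
  assumes p: "p = 1 / 2" and "N = Suc (length v + n)"
  shows "expectation (\<lambda>\<omega>. g (node_value N (\<lambda>u. \<eta> u \<omega>) v)) = mean n g"
  using assms(2)
proof (induction n arbitrary: v g)
  case 0
  then show ?case by (simp add: node_value.simps prob_space)
next
  case (Suc n)
  define A where "A = (\<lambda>b \<omega>. node_value N (\<lambda>u. \<eta> u \<omega>) (v @ [b]))"
  define X where "X = (\<lambda>\<omega>. node_value N (\<lambda>u. \<eta> u \<omega>) v)"
  have A_meas [measurable]: "A b \<in> measurable M (count_space UNIV)" for b
    unfolding A_def by (rule measurable_node)
  have vT: "v \<in> tree_vertices N"
    using Suc.prems by (simp add: tree_vertices_def)
  have \<eta>_meas [measurable]: "\<eta> v \<in> measurable M (count_space UNIV)"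
    using indep vT by (auto simp: indep_vars_def)
  have A_range: "A b \<omega> \<in> {1..2 ^ n}" for b \<omega>
    unfolding A_def by (rule node_value_bounds) (use Suc.prems in auto)
  have probA: "prob {\<omega> \<in> space M. A b \<omega> = i} = mass n i" for b i
  proof -
    have "prob {\<omega> \<in> space M. A b \<omega> = i} = expectation (\<lambda>\<omega>. indicator {\<omega> \<in> space M. A b \<omega> = i} \<omega>)"
      by simp
    also have "\<dots> = expectation (\<lambda>\<omega>. of_bool (A b \<omega> = i))"
      by (intro Bochner_Integration.integral_cong) auto
    also have "\<dots> = mass n i"
      unfolding A_def mass_def by (rule Suc.IH) (use Suc.prems in simp)
    finally show ?thesis .
  qed
  define P where "P = (\<lambda>c i j. {\<omega> \<in> space M. \<eta> v \<omega> = c \<and> A False \<omega> = i \<and> A True \<omega> = j})"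
  have P_sets [measurable]: "P c i j \<in> events" for c i j
    unfolding P_def by measurable
  have probP: "prob (P c i j) = mass n i * mass n j / 2" if "c \<in> {1, -1}" for c i j
    using node_indep[of v c i j] prob_plus[OF vT] prob_minus[OF vT] probA[of False i] probA[of True j] p that Suc.prems
    by (auto simp: P_def A_def)
  \<comment> \<open>The sign is an arbitrary integer a priori; it is almost surely 1 or -1 because
    the two probabilities add up to 1.\<close>
  have ae: "AE \<omega> in M. \<eta> v \<omega> = 1 \<or> \<eta> v \<omega> = -1"
  proof -
    have "prob ({\<omega> \<in> space M. \<eta> v \<omega> = 1} \<union> {\<omega> \<in> space M. \<eta> v \<omega> = -1}) =
        prob {\<omega> \<in> space M. \<eta> v \<omega> = 1} + prob {\<omega> \<in> space M. \<eta> v \<omega> = -1}"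
      by (intro finite_measure_Union) (auto, measurable)
    also have "\<dots> = 1"
      using prob_plus[OF vT] prob_minus[OF vT] by simp
    finally have "prob {\<omega> \<in> space M. \<eta> v \<omega> = 1 \<or> \<eta> v \<omega> = -1} = 1"
      by (simp add: Collect_disj_eq[symmetric] conj_disj_distribL[symmetric])
    then show ?thesis
      by (subst (asm) prob_Collect_eq_1) auto
  qed
  let ?R = "{1..2 ^ n}"
  \<comment> \<open>The child values have finite range, so g of the node value is almost surely a
    finite combination of indicators of the events \<open>P c i j\<close>, whose probabilities
    factor.\<close>
  have decomp: "AE \<omega> in M. g (X \<omega>) = (\<Sum>i\<in>?R. \<Sum>j\<in>?R. g (i + j) * indicator (P 1 i j) \<omega>)
      + (\<Sum>i\<in>?R. \<Sum>j\<in>?R. g (min i j) * indicator (P (-1) i j) \<omega>)"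
    using ae
  proof (rule AE_mp, intro AE_I2 impI)
    fix \<omega> assume w: "\<omega> \<in> space M" and c: "\<eta> v \<omega> = 1 \<or> \<eta> v \<omega> = -1"
    have Xw: "X \<omega> = (if \<eta> v \<omega> = 1 then A False \<omega> + A True \<omega> else min (A False \<omega>) (A True \<omega>))"
      using Suc.prems unfolding X_def A_def by (subst node_value.simps) simp
    have s: "(\<Sum>i\<in>?R. \<Sum>j\<in>?R. h i j * indicator (P c i j) \<omega>) =
        (if \<eta> v \<omega> = c then h (A False \<omega>) (A True \<omega>) else (0::real))" for h c
    proof -
      have "(\<Sum>i\<in>?R. \<Sum>j\<in>?R. h i j * indicator (P c i j) \<omega>) =
        (\<Sum>i\<in>?R. if i = A False \<omega> then (\<Sum>j\<in>?R. if j = A True \<omega> then (if \<eta> v \<omega> = c then h i j else 0) else 0) else 0)"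
        using w by (intro sum.cong refl) (auto simp: P_def indicator_def intro!: sum.cong sum.neutral)
      also have "\<dots> = (if \<eta> v \<omega> = c then h (A False \<omega>) (A True \<omega>) else 0)"
        using A_range[of False \<omega>] A_range[of True \<omega>] by (simp add: sum.delta)
      finally show ?thesis .
    qed
    show "g (X \<omega>) = (\<Sum>i\<in>?R. \<Sum>j\<in>?R. g (i + j) * indicator (P 1 i j) \<omega>)
      + (\<Sum>i\<in>?R. \<Sum>j\<in>?R. g (min i j) * indicator (P (-1) i j) \<omega>)"
      using c unfolding s Xw by auto
  qed
  have X_meas: "X \<in> measurable M (count_space UNIV)"
    unfolding X_def by (rule measurable_node)
  have int: "integrable M (\<lambda>\<omega>. \<Sum>i\<in>?R. \<Sum>j\<in>?R. h i j * indicator (P c i j) \<omega>)"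
    and exp: "expectation (\<lambda>\<omega>. \<Sum>i\<in>?R. \<Sum>j\<in>?R. h i j * indicator (P c i j) \<omega>) =
      (\<Sum>i\<in>?R. \<Sum>j\<in>?R. h i j * prob (P c i j))" for h :: "nat \<Rightarrow> nat \<Rightarrow> real" and c
  proof -
    have i: "integrable M (\<lambda>\<omega>. h i j * indicator (P c i j) \<omega>)" for i j
      by (intro integrable_mult_right integrable_real_indicator) (auto simp: emeasure_eq_measure)
    then show "integrable M (\<lambda>\<omega>. \<Sum>i\<in>?R. \<Sum>j\<in>?R. h i j * indicator (P c i j) \<omega>)"
      by (intro Bochner_Integration.integrable_sum)
    have "expectation (\<lambda>\<omega>. h i j * indicator (P c i j) \<omega>) = h i j * prob (P c i j)" for i j
      by simp
    then show "expectation (\<lambda>\<omega>. \<Sum>i\<in>?R. \<Sum>j\<in>?R. h i j * indicator (P c i j) \<omega>) =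
      (\<Sum>i\<in>?R. \<Sum>j\<in>?R. h i j * prob (P c i j))"
      by (subst Bochner_Integration.integral_sum, intro Bochner_Integration.integrable_sum i,
          subst Bochner_Integration.integral_sum, intro i, simp only:)
  qed
  have "expectation (\<lambda>\<omega>. g (X \<omega>)) = expectation (\<lambda>\<omega>. (\<Sum>i\<in>?R. \<Sum>j\<in>?R. g (i + j) * indicator (P 1 i j) \<omega>)
      + (\<Sum>i\<in>?R. \<Sum>j\<in>?R. g (min i j) * indicator (P (-1) i j) \<omega>))"
    by (rule integral_cong_AE[OF measurable_compose[OF X_meas] _ decomp])
       (simp, intro borel_measurable_add borel_measurable_integrable int)
  also have "\<dots> = (\<Sum>i\<in>?R. \<Sum>j\<in>?R. g (i + j) * prob (P 1 i j)) + (\<Sum>i\<in>?R. \<Sum>j\<in>?R. g (min i j) * prob (P (-1) i j))"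
    unfolding Bochner_Integration.integral_add[OF int int]
    using exp[of "\<lambda>i j. g (i + j)" 1] exp[of "\<lambda>i j. g (min i j)" "-1"] by argo
  also have "\<dots> = mean (Suc n) g"
  proof -
    have "(\<Sum>i\<in>?R. \<Sum>j\<in>?R. h i j * prob (P c i j)) = mean n (\<lambda>i. mean n (h i)) / 2"
      if "c \<in> {1, -1}" for c and h :: "nat \<Rightarrow> nat \<Rightarrow> real"
    proof -
      have "mean n (\<lambda>i. mean n (h i)) / 2 = (\<Sum>i\<in>?R. \<Sum>j\<in>?R. mass n i * (mass n j * h i j) / 2)"
        by (subst mean_eq_sum, subst mean_eq_sum) (simp only: sum_distrib_left sum_divide_distrib)
      then show ?thesis
        unfolding probP[OF that] by (simp only: mult_ac times_divide_eq_right)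
    qed
    from this[of 1 "\<lambda>i j. g (i + j)"] this[of "-1" "\<lambda>i j. g (min i j)"] show ?thesis
      by simp
  qed
  finally show ?case by (simp add: X_def)
qed

section \<open>Comparison with smooth profiles\<close>

text \<open>The argument is on the scale of the root value, where sums become convolutions; barriers
  live on the logarithmic scale and are compared at \<open>exp x\<close>.\<close>

definition dist_fun :: "nat \<Rightarrow> real \<Rightarrow> real" where
  "dist_fun n w = mean n (\<lambda>i. of_bool (real i \<le> w))"

lemma dist_fun_nonneg: "0 \<le> dist_fun n w"
  unfolding dist_fun_def by (rule mean_nonneg) simp

lemma dist_fun_le_1: "dist_fun n w \<le> 1"
  using mean_mono[of n "\<lambda>i. of_bool (real i \<le> w)" "\<lambda>_. 1"] by (simp add: dist_fun_def)

lemma dist_fun_eq_0: "w < 1 \<Longrightarrow> dist_fun n w = 0"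
  using mean_cong[of n "\<lambda>i. of_bool (real i \<le> w)" "\<lambda>_. 0"] by (simp add: dist_fun_def)

lemma dist_fun_0: "dist_fun 0 w = of_bool (1 \<le> w)"
  by (simp add: dist_fun_def)

text \<open>Inclusion-exclusion gives 2 F - F^2 for the minimum of two copies, and the sum gives the
  convolution of F with itself; the step averages the two.\<close>

lemma dist_fun_Suc:
  "dist_fun (Suc n) w = dist_fun n w - (dist_fun n w)\<^sup>2 / 2 + mean n (\<lambda>i. dist_fun n (w - real i)) / 2"
proof -
  have "mean n (\<lambda>i. mean n (\<lambda>j. of_bool (real (i + j) \<le> w))) = mean n (\<lambda>i. dist_fun n (w - real i))"
    by (simp add: dist_fun_def algebra_simps)
  moreover have "mean n (\<lambda>i. mean n (\<lambda>j. of_bool (real (min i j) \<le> w))) = 2 * dist_fun n w - (dist_fun n w)\<^sup>2"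
  proof -
    have "(of_bool (real (min i j) \<le> w) :: real) =
      of_bool (real i \<le> w) + of_bool (real j \<le> w) - of_bool (real i \<le> w) * of_bool (real j \<le> w)" for i j
      by (auto simp: min_def)
    then have "mean n (\<lambda>i. mean n (\<lambda>j. of_bool (real (min i j) \<le> w))) =
      mean n (\<lambda>i. of_bool (real i \<le> w) + dist_fun n w - dist_fun n w * of_bool (real i \<le> w))"
      by (simp add: mean_add mean_diff mean_cmult dist_fun_def mult.commute)
    also have "\<dots> = dist_fun n w + dist_fun n w - dist_fun n w * dist_fun n w"
      unfolding mean_add mean_diff mean_cmult by (simp add: dist_fun_def)
    finally show ?thesis by (simp add: power2_eq_square)
  qed
  ultimately show ?thesis
    by (simp add: dist_fun_def[of "Suc n"] add_divide_distrib diff_divide_distrib)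
qed

section \<open>Smooth profiles and their change in one step\<close>

text \<open>\<Phi> stands for a distribution function of the logarithm and \<rho> for its density.
  No bound by 1 is imposed, so that an uncapped parabola qualifies.\<close>

locale profile =
  fixes \<Phi> \<rho> :: "real \<Rightarrow> real" and b :: real
  assumes deriv: "\<And>x. (\<Phi> has_real_derivative \<rho> x) (at x)"
    and cont: "continuous_on UNIV \<rho>"
    and density_nonneg: "\<And>x. 0 \<le> \<rho> x"
    and eq_0: "\<And>x. x \<le> b \<Longrightarrow> \<Phi> x = 0"
begin

lemma density_eq_0: "x < b \<Longrightarrow> \<rho> x = 0"
proof -
  assume x: "x < b"
  have "((\<lambda>_. 0) has_real_derivative \<rho> x) (at x)"
    by (rule has_field_derivative_transform_within_open[OF deriv open_lessThan[of b]]) (use x eq_0 in auto)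
  then show ?thesis
    using DERIV_unique[OF DERIV_const] by metis
qed

lemma continuous: "continuous_on A \<Phi>"
  by (meson DERIV_continuous_on deriv DERIV_subset subset_UNIV has_field_derivative_at_within)

lemma density_has_integral: "b \<le> x \<Longrightarrow> (\<rho> has_integral \<Phi> x) {b..x}"
  using fundamental_theorem_of_calculus[of b x \<Phi> \<rho>] deriv eq_0[of b]
  by (simp add: has_real_derivative_iff_has_vector_derivative[symmetric] has_field_derivative_at_within)

lemma mono: "x \<le> y \<Longrightarrow> \<Phi> x \<le> \<Phi> y"
  using deriv density_nonneg by (meson DERIV_nonneg_imp_nondecreasing)

lemma nonneg: "0 \<le> \<Phi> x"
  using mono[of "min x b" x] eq_0[of "min x b"] by simp

text \<open>This is \<Phi> moved to the scale of the root value. Cutting off at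
  \<open>exp b\<close>, up to which the result is 0 anyway, makes it continuous on the whole line,
  also where the logarithm has no meaning.\<close>

definition scaled :: "real \<Rightarrow> real" where
  "scaled z = \<Phi> (ln (max z (exp b)))"

lemma scaled_eq_0: "z \<le> exp b \<Longrightarrow> scaled z = 0"
  by (simp add: scaled_def max_def eq_0)

lemma scaled_eq: "0 < z \<Longrightarrow> scaled z = \<Phi> (ln z)"
proof (cases "exp b \<le> z")
  case False
  moreover assume "0 < z"
  ultimately have "ln z \<le> b" using ln_mono[of z "exp b"] by simp
  with False show ?thesis by (simp add: scaled_eq_0 eq_0)
qed (simp add: scaled_def max_def)

lemma continuous_on_scaled: "continuous_on A scaled"
  unfolding scaled_def
proof (rule continuous_on_compose2[OF continuous[of UNIV]])
  have "max z (exp b) \<noteq> 0" for z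
    using exp_gt_zero[of b] by linarith
  then show "continuous_on A (\<lambda>z. ln (max z (exp b)))"
    by (intro continuous_intros) auto
qed simp

lemma shifted_has_integral:
  assumes "b \<le> x" "0 < k"
  shows "((\<lambda>y. \<rho> y * of_bool (k \<le> exp x - exp y)) has_integral scaled (exp x - k)) {b..x}"
proof (cases "exp x - k \<le> exp b")
  case True
  have "((\<lambda>y. \<rho> y * of_bool (k \<le> exp x - exp y)) has_integral 0) {b..x}"
  \<comment> \<open>The constraint can hold at most at the single point y = b.\<close>
  proof (rule has_integral_spike_finite[of "{b}" _ _ "\<lambda>_. 0"])
    fix y assume "y \<in> {b..x} - {b}"
    then have "exp b < exp y" by simp
    with True have "\<not> k \<le> exp x - exp y" by linarith
    then show "\<rho> y * of_bool (k \<le> exp x - exp y) = 0" by simp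
  qed auto
  with True show ?thesis by (simp add: scaled_eq_0)
next
  case False
  define m where "m = ln (exp x - k)"
  have pos: "0 < exp x - k"
    using False exp_gt_zero[of b] by linarith
  have em: "exp m = exp x - k"
    using pos by (simp add: m_def)
  have "b \<le> m" "m \<le> x"
    using False assms(2) em exp_le_cancel_iff[of b m] exp_le_cancel_iff[of m x] by linarith+
  then have "(\<rho> has_integral \<Phi> m) {b..m}" "{b..m} \<subseteq> {b..x}"
    using density_has_integral by auto
  then have "((\<lambda>y. if y \<in> {b..m} then \<rho> y else 0) has_integral \<Phi> m) {b..x}"
    by (simp only: has_integral_restrict)
  moreover have "(if y \<in> {b..m} then \<rho> y else 0) = \<rho> y * of_bool (k \<le> exp x - exp y)" if "y \<in> {b..x}" for y
  proof -
    have "k \<le> exp x - exp y \<longleftrightarrow> exp y \<le> exp m"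
      using em by linarith
    with that show ?thesis by simp
  qed
  ultimately have "((\<lambda>y. \<rho> y * of_bool (k \<le> exp x - exp y)) has_integral \<Phi> m) {b..x}"
    by (rule has_integral_eq[rotated])
  then show ?thesis
    unfolding scaled_eq[OF pos] m_def .
qed

text \<open>Both sides measure the pairs with exp y plus root value at most exp x, once sliced by y
  and once by the root value. This allows the two factors of a convolution to be replaced one at a
  time.\<close>

lemma convolution_has_integral:
  assumes "b \<le> x"
  shows "((\<lambda>y. \<rho> y * dist_fun n (exp x - exp y)) has_integral mean n (\<lambda>i. scaled (exp x - real i))) {b..x}"
proof -
  have "((\<lambda>y. \<Sum>k\<in>{1..2 ^ n}. mass n k * (\<rho> y * of_bool (real k \<le> exp x - exp y)))
    has_integral (\<Sum>k\<in>{1..2 ^ n}. mass n k * scaled (exp x - real k))) {b..x}"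
    by (intro has_integral_sum has_integral_mult_right shifted_has_integral assms) auto
  then show ?thesis
    unfolding dist_fun_def mean_eq_sum sum_distrib_left mult.left_commute[of "\<rho> _"] .
qed

text \<open>The mass of the pairs \<open>(y, z)\<close> with \<open>y, z \<le> x\<close> and \<open>exp y + exp z > exp x\<close>, integrated over \<open>y = x - s\<close>.\<close>

definition drop :: "real \<Rightarrow> real" where
  "drop x = integral {0<..} (\<lambda>s. \<rho> (x - s) * (\<Phi> x - \<Phi> (x - gap s)))"

text \<open>Substitute y = x - s. Since exp x - exp (x - s) = exp (x - gap s), the inner factor
  becomes \<Phi> (x - gap s).\<close>

lemma drop_has_integral_aux:
  assumes "b \<le> x"
  shows "((\<lambda>s. \<rho> (x - s) * (\<Phi> x - \<Phi> (x - gap s))) has_integral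
    (\<Phi> x)\<^sup>2 - integral {b..x} (\<lambda>y. \<rho> y * scaled (exp x - exp y))) {0<..}" (is "(?h has_integral ?I) _")
proof -
  have "(\<lambda>y. \<rho> y * scaled (exp x - exp y)) integrable_on {b..x}"
    by (intro integrable_continuous_interval continuous_intros continuous_on_subset[OF cont]
        continuous_on_compose2[OF continuous_on_scaled[of UNIV]]) auto
  then have "((\<lambda>y. \<rho> y * \<Phi> x - \<rho> y * scaled (exp x - exp y)) has_integral
      \<Phi> x * \<Phi> x - integral {b..x} (\<lambda>y. \<rho> y * scaled (exp x - exp y))) {b..x}"
    by (intro has_integral_diff has_integral_mult_left density_has_integral assms integrable_integral)
  from has_integral_affinity[of _ _ b x "-1" x, unfolded cbox_interval, OF this]
  have "((\<lambda>s. \<rho> (x - s) * \<Phi> x - \<rho> (x - s) * scaled (exp x - exp (x - s))) has_integral ?I)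
      ((\<lambda>s. x - s) ` {b..x})"
    by (simp add: power2_eq_square)
  also have "(\<lambda>s. x - s) ` {b..x} = {0..x - b}"
    by auto
  finally have "((\<lambda>s. \<rho> (x - s) * \<Phi> x - \<rho> (x - s) * scaled (exp x - exp (x - s))) has_integral ?I) {0<..x - b}"
    by (subst has_integral_spike_set_eq[where T = "{0..x - b}"])
       (auto intro: negligible_subset[OF negligible_finite[of "{0}"]])
  moreover have "\<rho> (x - s) * \<Phi> x - \<rho> (x - s) * scaled (exp x - exp (x - s)) = ?h s" if "s \<in> {0<..x - b}" for s
  proof -
    have "exp x - exp (x - s) = exp x * (1 - exp (- s))"
      by (simp add: right_diff_distrib exp_add[symmetric])
    moreover have "0 < 1 - exp (- s)"
      using that by simp
    ultimately have "0 < exp x - exp (x - s)" "ln (exp x - exp (x - s)) = x - gap s"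
      by (simp_all add: ln_mult gap_def)
    then show ?thesis
      using scaled_eq[of "exp x - exp (x - s)"] by (simp add: right_diff_distrib)
  qed
  ultimately have "(?h has_integral ?I) {0<..x - b}"
    by (rule has_integral_eq[rotated])
  then have "((\<lambda>s. if s \<in> {0<..x - b} then ?h s else 0) has_integral ?I) {0<..}"
    by (subst has_integral_restrict) auto
  \<comment> \<open>For s > x - b the point x - s lies left of b, where the density vanishes, so the
    range extends to all s > 0.\<close>
  moreover have "(if s \<in> {0<..x - b} then ?h s else 0) = ?h s" if "s \<in> {0<..}" for s
    using that density_eq_0[of "x - s"] by auto
  ultimately show ?thesis
    by (rule has_integral_eq[rotated])
qed

lemma drop_eq: "b \<le> x \<Longrightarrow> drop x = (\<Phi> x)\<^sup>2 - integral {b..x} (\<lambda>y. \<rho> y * scaled (exp x - exp y))"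
  unfolding drop_def by (rule integral_unique[OF drop_has_integral_aux])

lemma drop_below_aux: "x < b \<Longrightarrow> ((\<lambda>s. \<rho> (x - s) * (\<Phi> x - \<Phi> (x - gap s))) has_integral 0) {0<..}"
  by (intro has_integral_is_0) (use density_eq_0 in auto)

lemma drop_below: "x < b \<Longrightarrow> drop x = 0"
  unfolding drop_def by (rule integral_unique[OF drop_below_aux])

lemma drop_has_integral: "((\<lambda>s. \<rho> (x - s) * (\<Phi> x - \<Phi> (x - gap s))) has_integral drop x) {0<..}"
proof (cases "b \<le> x")
  case False
  then show ?thesis
    using drop_below_aux drop_below by simp
qed (use drop_has_integral_aux drop_eq in simp)

text \<open>In the convolution the profile is replaced by the larger distribution function, first
  under the integral and then, after \<open>convolution_has_integral\<close>, under
  \<open>mean\<close>. The remaining part of the recursion is monotone because f - f^2 / 2 increases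
  for f <= 1.\<close>

lemma dist_fun_step_ge:
  assumes "\<And>x. \<Phi> x \<le> dist_fun n (exp x)"
  shows "\<Phi> x - drop x / 2 \<le> dist_fun (Suc n) (exp x)"
proof (cases "b \<le> x")
  case True
  have le: "scaled z \<le> dist_fun n z" for z
  proof (cases "z \<le> exp b")
    case False
    then have "0 < z" using exp_gt_zero[of b] by linarith
    then show ?thesis using scaled_eq[of z] assms[of "ln z"] by simp
  qed (simp add: scaled_eq_0 dist_fun_nonneg)
  have "(\<Phi> x)\<^sup>2 - drop x = integral {b..x} (\<lambda>y. \<rho> y * scaled (exp x - exp y))"
    using drop_eq[OF True] by simp
  also have "\<dots> \<le> integral {b..x} (\<lambda>y. \<rho> y * dist_fun n (exp x - exp y))"
  proof (rule integral_le)
    show "(\<lambda>y. \<rho> y * scaled (exp x - exp y)) integrable_on {b..x}"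
      by (intro integrable_continuous_interval continuous_intros continuous_on_subset[OF cont]
          continuous_on_compose2[OF continuous_on_scaled[of UNIV]]) auto
    show "(\<lambda>y. \<rho> y * dist_fun n (exp x - exp y)) integrable_on {b..x}"
      using convolution_has_integral[OF True] by blast
  qed (use le density_nonneg in \<open>auto intro: mult_left_mono\<close>)
  also have "\<dots> = mean n (\<lambda>i. scaled (exp x - real i))"
    using convolution_has_integral[OF True] by (rule integral_unique)
  also have "\<dots> \<le> mean n (\<lambda>i. dist_fun n (exp x - real i))"
    by (intro mean_mono le)
  finally have "\<Phi> x - drop x / 2 \<le> \<Phi> x - (\<Phi> x)\<^sup>2 / 2 + mean n (\<lambda>i. dist_fun n (exp x - real i)) / 2"
    by simp
  also have "\<Phi> x - (\<Phi> x)\<^sup>2 / 2 \<le> dist_fun n (exp x) - (dist_fun n (exp x))\<^sup>2 / 2"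
  proof -
    have "0 \<le> (dist_fun n (exp x) - \<Phi> x) * (2 - dist_fun n (exp x) - \<Phi> x)"
      using assms[of x] dist_fun_le_1[of n "exp x"] by (intro mult_nonneg_nonneg) auto
    then show ?thesis by (simp add: algebra_simps power2_eq_square)
  qed
  finally show ?thesis by (simp add: dist_fun_Suc)
qed (use dist_fun_nonneg in \<open>simp add: drop_below eq_0\<close>)

text \<open>Here \<open>\<Phi>\<close> may exceed \<open>1\<close>, where \<open>f - f\<^sup>2 / 2\<close> is no longer increasing in \<open>f\<close>; this costs the last term.\<close>

lemma dist_fun_step_le:
  assumes "\<And>x. dist_fun n (exp x) \<le> \<Phi> x"
  shows "dist_fun (Suc n) (exp x) \<le> \<Phi> x - drop x / 2 + (max 0 (\<Phi> x - 1))\<^sup>2 / 2"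
proof -
  have le: "dist_fun n z \<le> scaled z" for z
  proof (cases "0 < z")
    case True
    then show ?thesis using scaled_eq[of z] assms[of "ln z"] by simp
  qed (use nonneg in \<open>simp add: dist_fun_eq_0 scaled_def\<close>)
  have mean: "mean n (\<lambda>i. dist_fun n (exp x - real i)) \<le> (\<Phi> x)\<^sup>2 - drop x"
  proof (cases "b \<le> x")
    case True
    have "mean n (\<lambda>i. dist_fun n (exp x - real i)) \<le> mean n (\<lambda>i. scaled (exp x - real i))"
      by (intro mean_mono le)
    also have "\<dots> = integral {b..x} (\<lambda>y. \<rho> y * dist_fun n (exp x - exp y))"
      using convolution_has_integral[OF True] by (rule integral_unique[symmetric])
    also have "\<dots> \<le> integral {b..x} (\<lambda>y. \<rho> y * scaled (exp x - exp y))"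
    proof (rule integral_le)
      show "(\<lambda>y. \<rho> y * scaled (exp x - exp y)) integrable_on {b..x}"
        by (intro integrable_continuous_interval continuous_intros continuous_on_subset[OF cont]
            continuous_on_compose2[OF continuous_on_scaled[of UNIV]]) auto
      show "(\<lambda>y. \<rho> y * dist_fun n (exp x - exp y)) integrable_on {b..x}"
        using convolution_has_integral[OF True] by blast
    qed (use le density_nonneg in \<open>auto intro: mult_left_mono\<close>)
    also have "\<dots> = (\<Phi> x)\<^sup>2 - drop x"
      using drop_eq[OF True] by simp
    finally show ?thesis .
  next
    case False
    have "mean n (\<lambda>i. dist_fun n (exp x - real i)) \<le> mean n (\<lambda>i. scaled (exp x - real i))"
      by (intro mean_mono le)
    also have "\<dots> = mean n (\<lambda>i. 0)"
    proof (rule arg_cong[of _ _ "mean n"], rule ext)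
      fix i
      have "exp x - real i \<le> exp b"
        using False by (smt (verit) exp_less_mono of_nat_0_le_iff)
      then show "scaled (exp x - real i) = 0" by (rule scaled_eq_0)
    qed
    finally show ?thesis
      using False by (simp add: drop_below eq_0)
  qed
  have "dist_fun n (exp x) - (dist_fun n (exp x))\<^sup>2 / 2 \<le> \<Phi> x - (\<Phi> x)\<^sup>2 / 2 + (max 0 (\<Phi> x - 1))\<^sup>2 / 2"
  proof (cases "\<Phi> x \<le> 1")
    case True
    have "0 \<le> (\<Phi> x - dist_fun n (exp x)) * (2 - dist_fun n (exp x) - \<Phi> x)"
      using assms[of x] True dist_fun_le_1[of n "exp x"] by (intro mult_nonneg_nonneg) auto
    moreover have "max 0 (\<Phi> x - 1) = 0" using True by simp
    ultimately show ?thesis by (simp add: algebra_simps power2_eq_square)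
  next
    case False
    \<comment> \<open>For \<Phi> x > 1 the right-hand side equals 1/2, the maximum of f - f^2 /
      2.\<close>
    have "0 \<le> (1 - dist_fun n (exp x))\<^sup>2" by simp
    moreover have "max 0 (\<Phi> x - 1) = \<Phi> x - 1" using False by simp
    ultimately show ?thesis by (simp add: field_simps power2_eq_square)
  qed
  with mean show ?thesis by (simp add: dist_fun_Suc)
qed

text \<open>The hypothesis \<open>tail\<close> compares the density to the left of x with \<rho> x.
  It bounds \<rho> (x - s) directly and the increment over \<open>gap s\<close> through the mean
  value theorem, so \<rho> x is squared and the rest is the weighted integral of
  \<open>gap\<close>.\<close>

lemma drop_le:
  assumes \<gamma>: "0 \<le> \<gamma>" "\<gamma> \<le> 1 / 8"
    and tail: "\<And>x s. 0 \<le> s \<Longrightarrow> \<rho> (x - s) \<le> \<rho> x * exp (\<gamma> * s)"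
  shows "drop x \<le> (\<rho> x)\<^sup>2 * integral {0<..} (\<lambda>s. gap s * exp (\<gamma> * (s + gap s)))"
proof (rule has_integral_le[OF drop_has_integral])
  show "((\<lambda>s. (\<rho> x)\<^sup>2 * (gap s * exp (\<gamma> * (s + gap s)))) has_integral
      (\<rho> x)\<^sup>2 * integral {0<..} (\<lambda>s. gap s * exp (\<gamma> * (s + gap s)))) {0<..}"
    by (intro has_integral_mult_right integrable_integral gap_exp_integrable \<gamma>)
  show "\<rho> (x - s) * (\<Phi> x - \<Phi> (x - gap s)) \<le> (\<rho> x)\<^sup>2 * (gap s * exp (\<gamma> * (s + gap s)))" if "s \<in> {0<..}" for s
  proof -
    have t: "0 < gap s" using gap_pos that by simp
    obtain z where z: "x - gap s < z" "z < x" "\<Phi> x - \<Phi> (x - gap s) = (x - (x - gap s)) * \<rho> z"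
      using MVT2[of "x - gap s" x \<Phi> \<rho>] deriv t by auto
    have "\<rho> z \<le> \<rho> x * exp (\<gamma> * (x - z))"
      using tail[of "x - z" x] z by simp
    also have "\<dots> \<le> \<rho> x * exp (\<gamma> * gap s)"
      using z \<gamma> density_nonneg[of x] by (intro mult_left_mono) (auto intro!: mult_left_mono)
    finally have "\<Phi> x - \<Phi> (x - gap s) \<le> gap s * (\<rho> x * exp (\<gamma> * gap s))"
      using t z by simp
    then have "\<rho> (x - s) * (\<Phi> x - \<Phi> (x - gap s)) \<le> (\<rho> x * exp (\<gamma> * s)) * (gap s * (\<rho> x * exp (\<gamma> * gap s)))"
      using tail[of s x] that density_nonneg mono[of "x - gap s" x] t by (intro mult_mono) auto
    also have "\<dots> = (\<rho> x)\<^sup>2 * (gap s * exp (\<gamma> * (s + gap s)))"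
      by (simp add: power2_eq_square distrib_left exp_add mult_ac)
    finally show ?thesis .
  qed
qed

end

section \<open>Upper bound\<close>

lemma DERIV_glue:
  fixes f g :: "real \<Rightarrow> real"
  assumes f: "\<And>x. x \<le> c \<Longrightarrow> (f has_real_derivative f' x) (at x)"
    and g: "\<And>x. c \<le> x \<Longrightarrow> (g has_real_derivative g' x) (at x)"
    and eq: "f c = g c" "f' c = g' c"
  shows "((\<lambda>x. if x \<le> c then f x else g x) has_real_derivative (if x \<le> c then f' x else g' x)) (at x)"
proof -
  have cl: "closure {..c} \<inter> closure {c<..} = {c}"
    by auto
  have "((\<lambda>x. if x \<in> {..c} then f x else g x) has_vector_derivative (if x \<in> {..c} then f' x else g' x))
      (at x within UNIV)"
  proof (rule has_vector_derivative_If_within_closures[where T = "{c<..}"])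
    show "(f has_vector_derivative f' x) (at x within {..c} \<union> (closure {..c} \<inter> closure {c<..}))"
      if "x \<in> {..c} \<union> (closure {..c} \<inter> closure {c<..})"
      using f[of x] that unfolding cl
      by (auto simp: has_real_derivative_iff_has_vector_derivative intro: has_vector_derivative_at_within)
    show "(g has_vector_derivative g' x) (at x within {c<..} \<union> (closure {..c} \<inter> closure {c<..}))"
      if "x \<in> {c<..} \<union> (closure {..c} \<inter> closure {c<..})"
      using g[of x] that unfolding cl
      by (auto simp: has_real_derivative_iff_has_vector_derivative intro: has_vector_derivative_at_within)
    show "f x = g x" "f' x = g' x" if "x \<in> closure {..c}" "x \<in> closure {c<..}"
      using that eq by auto
  qed auto
  then show ?thesis
    by (simp add: has_real_derivative_iff_has_vector_derivative)
qed

lemma continuous_on_glue: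
  fixes f g :: "real \<Rightarrow> real"
  assumes "continuous_on UNIV f" "continuous_on UNIV g" "f c = g c"
  shows "continuous_on UNIV (\<lambda>x. if x \<le> c then f x else g x)"
  using assms by (intro continuous_on_cases_1) (auto intro: continuous_on_subset)

text \<open>Layer-cake formula: min L (ln k) is the length of the part of [0, L] where exp x <
  k.\<close>

lemma tail_has_integral:
  assumes "0 \<le> L"
  shows "((\<lambda>x. 1 - dist_fun n (exp x)) has_integral mean n (\<lambda>i. min L (ln (real i)))) {0..L}"
proof -
  have "((\<lambda>x. of_bool (exp x < real k)) has_integral min L (ln (real k))) {0..L}" if k: "k \<in> {1..2 ^ n}" for k
  proof -
    define m where "m = min L (ln (real k))"
    have m: "0 \<le> m" "m \<le> L" using assms k by (auto simp: m_def)
    have "((\<lambda>_::real. 1::real) has_integral m) {0..m}"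
      using has_integral_const_real[of "1::real" 0 m] m by simp
    moreover have "{0..m} \<subseteq> {0..L}" using m by auto
    ultimately have "((\<lambda>x. if x \<in> {0..m} then 1 else 0) has_integral m) {0..L}"
      by (simp only: has_integral_restrict)
    then show ?thesis
      unfolding m_def[symmetric]
    proof (rule has_integral_spike_finite[of "{m}", rotated 2])
      fix x assume x: "x \<in> {0..L} - {m}"
      have "exp x < real k \<longleftrightarrow> x < ln (real k)"
        using k by (subst exp_less_cancel_iff[symmetric]) simp
      then show "of_bool (exp x < real k) = (if x \<in> {0..m} then 1 else 0 :: real)"
        using x by (auto simp: m_def)
    qed simp
  qed
  then have "((\<lambda>x. \<Sum>k\<in>{1..2 ^ n}. mass n k * of_bool (exp x < real k)) has_integral
      (\<Sum>k\<in>{1..2 ^ n}. mass n k * min L (ln (real k)))) {0..L}"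
    by (intro has_integral_sum has_integral_mult_right) auto
  then have "((\<lambda>x. mean n (\<lambda>i. of_bool (exp x < real i))) has_integral mean n (\<lambda>i. min L (ln (real i)))) {0..L}"
    by (simp only: mean_eq_sum)
  moreover have "mean n (\<lambda>i. of_bool (exp x < real i)) = 1 - dist_fun n (exp x)" for x
  proof -
    have "(of_bool (exp x < real i) :: real) = 1 - of_bool (real i \<le> exp x)" for i
      by auto
    then show ?thesis by (simp add: dist_fun_def mean_diff)
  qed
  ultimately show ?thesis by simp
qed

lemma mean_ln_ge:
  assumes "0 \<le> L" "(h has_integral I) {0..L}" "\<And>x. x \<in> {0..L} \<Longrightarrow> h x \<le> 1 - dist_fun n (exp x)"
  shows "I \<le> mean n (\<lambda>i. ln (real i))"
proof -
  have "I \<le> mean n (\<lambda>i. min L (ln (real i)))"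
    by (rule has_integral_le[OF assms(2) tail_has_integral[OF assms(1)] assms(3)])
  also have "\<dots> \<le> mean n (\<lambda>i. ln (real i))"
    by (rule mean_mono) simp
  finally show ?thesis .
qed

lemma mean_ln_le:
  assumes "\<And>L. 0 \<le> L \<Longrightarrow> (h has_integral I L) {0..L}" "\<And>L. 0 \<le> L \<Longrightarrow> I L \<le> m"
    "\<And>x. 0 \<le> x \<Longrightarrow> 1 - dist_fun n (exp x) \<le> h x"
  shows "mean n (\<lambda>i. ln (real i)) \<le> m"
proof -
  \<comment> \<open>The root value is at most 2^n at this level, so truncating its logarithm at L
    changes nothing.\<close>
  define L where "L = ln (2 ^ n :: real)"
  have L: "0 \<le> L" by (simp add: L_def)
  have "ln (real i) \<le> L" if "i \<in> {1..2 ^ n}" for i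
  proof -
    have "real i \<le> real (2 ^ n)" using that by (subst of_nat_le_iff) simp
    then show ?thesis using that by (simp add: L_def)
  qed
  then have "mean n (\<lambda>i. ln (real i)) = mean n (\<lambda>i. min L (ln (real i)))"
    by (intro mean_cong) (metis min.absorb2)
  also have "\<dots> \<le> I L"
    by (rule has_integral_le[OF tail_has_integral[OF L] assms(1)[OF L]]) (use assms(3) in auto)
  also have "\<dots> \<le> m" by (rule assms(2)[OF L])
  finally show ?thesis .
qed

section \<open>The self-similar barrier from below\<close>

text \<open>The capped parabola itself violates the hypothesis \<open>tail\<close> of
  \<open>drop_le\<close>, its density being 0 beyond the front. Switching at u0 < 1 to an
  exponential approach to 1 repairs this, at a cost that vanishes as u0 tends to 1.\<close>

locale upper_shape =
  fixes u0 :: real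
  assumes u0: "0 < u0" "u0 < 1"
begin

text \<open>This rate makes \<open>shape\<close> continuously differentiable at \<open>u0\<close>.\<close>

definition rate where "rate = 2 * u0 / (1 - u0\<^sup>2)"
definition shape where "shape u = (if u \<le> 0 then 0 else if u \<le> u0 then u\<^sup>2 else 1 - (1 - u0\<^sup>2) * exp (- rate * (u - u0)))"
definition shape' where "shape' u = (if u \<le> 0 then 0 else if u \<le> u0 then 2 * u else 2 * u0 * exp (- rate * (u - u0)))"

lemma u0_sq: "u0\<^sup>2 < 1"
  using u0 by (simp add: power_less_one_iff abs_square_less_1)

lemma rate_pos: "0 < rate"
  using u0 u0_sq by (simp add: rate_def)

lemma rate_eq: "(1 - u0\<^sup>2) * rate = 2 * u0"
  using u0_sq by (simp add: rate_def)

lemma shape_deriv: "(shape has_real_derivative shape' u) (at u)"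
proof -
  have "((\<lambda>u. if u \<le> u0 then u\<^sup>2 else 1 - (1 - u0\<^sup>2) * exp (- rate * (u - u0))) has_real_derivative
    (if u \<le> u0 then 2 * u else 2 * u0 * exp (- rate * (u - u0)))) (at u)" for u
  proof (rule DERIV_glue)
    show "((\<lambda>u. 1 - (1 - u0\<^sup>2) * exp (- rate * (u - u0))) has_real_derivative 2 * u0 * exp (- rate * (x - u0))) (at x)" for x
      by (auto intro!: derivative_eq_intros simp: rate_eq[symmetric])
  qed (auto intro!: derivative_eq_intros)
  note inner = this
  show ?thesis
    unfolding shape_def shape'_def by (rule DERIV_glue[OF _ inner]) (use u0 in auto)
qed

lemma shape'_cont: "continuous_on UNIV shape'"
  unfolding shape'_def
  by (intro continuous_on_glue continuous_intros) (use u0 in auto)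

lemma shape'_nonneg: "0 \<le> shape' u"
  using u0 by (simp add: shape'_def)

lemma shape_le_1: "shape u \<le> 1"
  using u0 u0_sq by (auto simp: shape_def intro: power_le_one)

lemma shape_eq_0: "u \<le> 0 \<Longrightarrow> shape u = 0"
  by (simp add: shape_def)

text \<open>Up to u0 the derivative does not decrease, and beyond u0 it decays exactly at rate
  \<open>rate\<close>.\<close>

lemma shape'_tail: "0 \<le> w \<Longrightarrow> shape' (u - w) \<le> shape' u * exp (rate * w)"
proof -
  assume w: "0 \<le> w"
  have 1: "1 \<le> exp (rate * w)"
    using w rate_pos by simp
  consider "u \<le> 0" | "0 < u" "u \<le> u0" | "u0 < u" "u - w \<le> u0" | "u0 < u - w"
    using w by linarith
  then show ?thesis
  proof cases
    case 1
    then show ?thesis using w by (simp add: shape'_def)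
  next
    case 2
    have "shape' (u - w) \<le> 2 * u * 1"
      using 2 w by (simp add: shape'_def)
    also have "\<dots> \<le> 2 * u * exp (rate * w)"
      using 1 2 by (intro mult_left_mono) auto
    finally show ?thesis using 2 by (simp add: shape'_def)
  next
    case 3
    have "shape' (u - w) \<le> 2 * u0 * 1"
      using 3 u0 by (simp add: shape'_def)
    also have "\<dots> \<le> 2 * u0 * exp (rate * (w - (u - u0)))"
      using 3 u0 rate_pos by (intro mult_left_mono) auto
    also have "\<dots> = shape' u * exp (rate * w)"
      using 3 u0 by (simp add: shape'_def exp_add[symmetric] algebra_simps)
    finally show ?thesis .
  next
    case 4
    then show ?thesis using u0 w by (simp add: shape'_def exp_add[symmetric] algebra_simps)
  qed
qed

text \<open>The quotient shape' u / u is nonincreasing for u > 0, so \<open>shape\<close> is concave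
  as a function of u^2.\<close>

lemma shape'_over_id: "0 < w \<Longrightarrow> w \<le> u \<Longrightarrow> shape' u * w \<le> shape' w * u"
proof -
  assume w: "0 < w" "w \<le> u"
  consider "u \<le> u0" | "u0 < u" "w \<le> u0" | "u0 < w"
    by linarith
  then show ?thesis
  proof cases
    case 1
    then show ?thesis using w by (simp add: shape'_def)
  next
    case 2
    have "u0 * exp (- rate * (u - u0)) \<le> u * 1"
      using 2 u0 rate_pos by (intro mult_mono) auto
    then have "2 * w * (u0 * exp (- rate * (u - u0))) \<le> 2 * w * (u * 1)"
      using w by (intro mult_left_mono) auto
    then show ?thesis using 2 w u0 by (simp add: shape'_def mult_ac)
  next
    case 3
    have "exp (- rate * (u - u0)) * w \<le> exp (- rate * (w - u0)) * u"
      using 3 w u0 rate_pos by (intro mult_mono) auto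
    then have "2 * u0 * (exp (- rate * (u - u0)) * w) \<le> 2 * u0 * (exp (- rate * (w - u0)) * u)"
      using u0 by (intro mult_left_mono) auto
    then show ?thesis using 3 w u0 by (simp add: shape'_def mult_ac)
  qed
qed

text \<open>The tangent inequality for that concave function, with slope shape' u / (2 * u) in the
  variable u^2.\<close>

lemma shape_diff_ge:
  assumes "0 < v" "v \<le> u"
  shows "shape' u * (u\<^sup>2 - v\<^sup>2) / (2 * u) \<le> shape u - shape v"
proof -
  define k where "k = shape' u / (2 * u)"
  have "shape v - k * v\<^sup>2 \<le> shape u - k * u\<^sup>2"
  proof (rule DERIV_nonneg_imp_nondecreasing[OF assms(2)])
    fix w assume w: "v \<le> w" "w \<le> u"
    have "((\<lambda>w. shape w - k * w\<^sup>2) has_real_derivative shape' w - k * (2 * w)) (at w)"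
      by (auto intro!: derivative_eq_intros shape_deriv)
    moreover have "0 \<le> shape' w - k * (2 * w)"
      using shape'_over_id[of w u] assms w by (simp add: k_def field_simps)
    ultimately show "\<exists>y. ((\<lambda>w. shape w - k * w\<^sup>2) has_real_derivative y) (at w) \<and> 0 \<le> y"
      by blast
  qed
  then have "k * (u\<^sup>2 - v\<^sup>2) \<le> shape u - shape v"
    by (simp add: right_diff_distrib)
  then show ?thesis by (simp add: k_def)
qed

lemma shape'_le: "0 \<le> u \<Longrightarrow> shape' u \<le> 2 * u"
  using u0 rate_pos mult_mono[of u0 u "exp (- rate * (u - u0))" 1] by (simp add: shape'_def)

lemma profile_shape:
  assumes "0 < a"
  shows "profile (\<lambda>x. shape (x / a)) (\<lambda>x. shape' (x / a) / a) 0"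
proof
  show "((\<lambda>x. shape (x / a)) has_real_derivative shape' (x / a) / a) (at x)" for x
    using DERIV_chain2[OF shape_deriv, of "\<lambda>x. x / a" "1 / a" x UNIV] DERIV_cdivide[OF DERIV_ident, of a x]
    by simp
  show "continuous_on UNIV (\<lambda>x. shape' (x / a) / a)"
    by (intro continuous_intros continuous_on_compose2[OF shape'_cont]) (use assms in auto)
qed (use assms shape'_nonneg shape_eq_0 in \<open>auto simp: divide_le_0_iff\<close>)

text \<open>Widening the front lowers u^2 by u^2 * L / a'^2, which is at least u^2 * 2 * J / a^2 by
  the hypothesis on J. Concavity in u^2 makes the loss of height at least shape' u * u * J / a^2 for
  J >= 0, and shape' u <= 2 * u concludes.\<close>

lemma shape_spread:
  assumes a: "0 < a" and a': "a' = sqrt (a\<^sup>2 + L)" and L: "0 < L" and J: "2 * J * (a\<^sup>2 + L) \<le> L * a\<^sup>2"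
  shows "shape (x / a') \<le> shape (x / a) - (shape' (x / a) / a)\<^sup>2 * J / 2"
proof (cases "x \<le> 0")
  case True
  have "0 < a'" using a L by (simp add: a' add_pos_pos)
  with True a have "x / a' \<le> 0" "x / a \<le> 0" by (simp_all add: divide_le_0_iff)
  then show ?thesis by (simp add: shape_def shape'_def)
next
  case False
  define u v r where "u = x / a" and "v = x / a'" and "r = shape' u"
  have a'2: "a'\<^sup>2 = a\<^sup>2 + L" and a'0: "0 < a'"
    using a L by (simp_all add: a' add_pos_pos)
  have "a \<le> a'"
    using a'2 a'0 L by (intro power2_le_imp_le[of a a']) auto
  then have v: "0 < v" "v \<le> u" and u: "0 < u"
    using False a a'0 by (auto simp: u_def v_def intro: divide_left_mono)
  have r: "0 \<le> r" "r \<le> 2 * u"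
    using shape'_nonneg shape'_le u by (auto simp: r_def)
  have "2 * J / a\<^sup>2 \<le> L / a'\<^sup>2"
  proof -
    have "2 * J * a'\<^sup>2 \<le> L * a\<^sup>2" using J a'2 by simp
    then show ?thesis using a a'0 by (simp add: field_simps)
  qed
  moreover have "u\<^sup>2 - v\<^sup>2 = u\<^sup>2 * (L / a'\<^sup>2)"
  proof -
    have "v\<^sup>2 = u\<^sup>2 * (a\<^sup>2 / a'\<^sup>2)" using a by (simp add: u_def v_def power_divide)
    moreover have "1 - a\<^sup>2 / a'\<^sup>2 = (a'\<^sup>2 - a\<^sup>2) / a'\<^sup>2"
      using a'0 by (simp add: diff_divide_distrib)
    then have "1 - a\<^sup>2 / a'\<^sup>2 = L / a'\<^sup>2"
      by (simp add: a'2)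
    ultimately show ?thesis
      using right_diff_distrib[of "u\<^sup>2" 1 "a\<^sup>2 / a'\<^sup>2"] by simp
  qed
  ultimately have uv: "u\<^sup>2 * (2 * J / a\<^sup>2) \<le> u\<^sup>2 - v\<^sup>2"
    using mult_left_mono[of "2 * J / a\<^sup>2" "L / a'\<^sup>2" "u\<^sup>2"] by simp
  show ?thesis
  proof (cases "0 \<le> J")
    case True
    have "(r / a)\<^sup>2 * J / 2 = r * (r * (J / (2 * a\<^sup>2)))"
      by (simp add: power2_eq_square)
    also have "\<dots> \<le> r * (2 * u * (J / (2 * a\<^sup>2)))"
      using r True by (intro mult_left_mono mult_right_mono) auto
    also have "\<dots> = r * (u\<^sup>2 * (2 * J / a\<^sup>2)) / (2 * u)"
      using u by (simp add: power2_eq_square)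
    also have "\<dots> \<le> r * (u\<^sup>2 - v\<^sup>2) / (2 * u)"
      using uv r u by (intro divide_right_mono mult_left_mono) auto
    also have "\<dots> \<le> shape u - shape v"
      unfolding r_def by (rule shape_diff_ge[OF v])
    finally show ?thesis by (simp add: u_def v_def r_def)
  next
    case False
    have "(r / a)\<^sup>2 * J / 2 \<le> 0"
      using False by (simp add: mult_nonneg_nonpos)
    moreover have "shape v \<le> shape u"
      using profile.mono[OF profile_shape[of 1] v(2)] by simp
    ultimately show ?thesis by (simp add: u_def v_def r_def)
  qed
qed

text \<open>The integral of 1 - shape over the positive axis; the last term is (1 - u0^2) / rate. It
  equals 2/3 at u0 = 1.\<close>

definition total where "total = u0 - u0 ^ 3 / 3 + (1 - u0\<^sup>2)\<^sup>2 / (2 * u0)"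

definition tail_prim where
  "tail_prim u = (if u \<le> u0 then u - u ^ 3 / 3 else total - (1 - u0\<^sup>2) / rate * exp (- rate * (u - u0)))"

lemma tail_prim_deriv: "(tail_prim has_real_derivative (if u \<le> u0 then 1 - u\<^sup>2 else (1 - u0\<^sup>2) * exp (- rate * (u - u0)))) (at u)"
  unfolding tail_prim_def
proof (rule DERIV_glue)
  show "((\<lambda>u. total - (1 - u0\<^sup>2) / rate * exp (- rate * (u - u0))) has_real_derivative (1 - u0\<^sup>2) * exp (- rate * (x - u0))) (at x)" for x
    using rate_pos by (auto intro!: derivative_eq_intros)
  have "(1 - u0\<^sup>2) / rate = (1 - u0\<^sup>2)\<^sup>2 / (2 * u0)"
    by (simp add: rate_def power2_eq_square)
  then show "u0 - u0 ^ 3 / 3 = total - (1 - u0\<^sup>2) / rate * exp (- rate * (u0 - u0))"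
    by (simp add: total_def)
qed (auto intro!: derivative_eq_intros)

lemma tail_prim_le: "0 \<le> u \<Longrightarrow> tail_prim u \<le> total"
proof (cases "u \<le> u0")
  case True
  assume "0 \<le> u"
  have "u * u \<le> 1" "u0 * u \<le> 1" "u0 * u0 \<le> 1"
    using True \<open>0 \<le> u\<close> u0 by (auto intro!: mult_le_one)
  then have "0 \<le> (u0 - u) * (1 - (u0 * u0 + u0 * u + u * u) / 3)"
    using True by (intro mult_nonneg_nonneg) auto
  also have "\<dots> = (u0 - u0 ^ 3 / 3) - (u - u ^ 3 / 3)"
    by (simp add: power3_eq_cube field_simps)
  finally have "u - u ^ 3 / 3 \<le> u0 - u0 ^ 3 / 3" by simp
  moreover have "0 \<le> (1 - u0\<^sup>2)\<^sup>2 / (2 * u0)" using u0 by simp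
  ultimately show ?thesis
    using True by (simp add: tail_prim_def total_def)
next
  case False
  have "0 \<le> (1 - u0\<^sup>2) / rate * exp (- rate * (u - u0))"
    using u0_sq rate_pos by (intro mult_nonneg_nonneg divide_nonneg_nonneg) auto
  with False show ?thesis by (simp add: tail_prim_def)
qed

lemma mean_ln_le_total:
  assumes "0 < a" "\<And>x. shape (x / a) \<le> dist_fun n (exp x)"
  shows "mean n (\<lambda>i. ln (real i)) \<le> a * total"
proof (rule mean_ln_le)
  show "((\<lambda>x. 1 - shape (x / a)) has_integral a * tail_prim (L / a) - a * tail_prim (0 / a)) {0..L}" if "0 \<le> L" for L
  proof (rule fundamental_theorem_of_calculus[OF that])
    fix x assume x: "x \<in> {0..L}"
    have "((\<lambda>x. a * tail_prim (x / a)) has_real_derivative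
      a * ((if x / a \<le> u0 then 1 - (x / a)\<^sup>2 else (1 - u0\<^sup>2) * exp (- rate * (x / a - u0))) * (1 / a))) (at x)"
      using DERIV_cmult[OF DERIV_chain2[OF tail_prim_deriv, of "\<lambda>x. x / a" "1 / a" x UNIV], of a]
        DERIV_cdivide[OF DERIV_ident, of a x] by simp
    moreover have "(if x / a \<le> u0 then 1 - (x / a)\<^sup>2 else (1 - u0\<^sup>2) * exp (- rate * (x / a - u0))) = 1 - shape (x / a)"
    proof (cases "x = 0")
      case False
      then have "0 < x / a" using x assms by simp
      then show ?thesis by (simp add: shape_def)
    qed (use u0 in \<open>simp add: shape_def\<close>)
    ultimately show "((\<lambda>x. a * tail_prim (x / a)) has_vector_derivative 1 - shape (x / a)) (at x within {0..L})"
      using assms(1) by (auto simp: has_real_derivative_iff_has_vector_derivative intro: has_vector_derivative_at_within)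
  qed
  show "a * tail_prim (L / a) - a * tail_prim (0 / a) \<le> a * total" if "0 \<le> L" for L
    using tail_prim_le[of "L / a"] that assms(1) u0 by (simp add: tail_prim_def[of 0])
  show "1 - dist_fun n (exp x) \<le> 1 - shape (x / a)" for x
    using assms(2)[of x] by simp
qed

text \<open>As L > pi^2 / 3, a small tail rate gives a drop of at most J times the squared density
  with 2 * J < L. Letting a^2 grow by L per level then lowers the barrier by at least half the drop,
  so it stays below the distribution function.\<close>

lemma mean_ln_upper:
  assumes L: "L > pi\<^sup>2 / 3"
  obtains q where "0 < q" "\<And>n. mean n (\<lambda>i. ln (real i)) \<le> sqrt (q + L * real n) * total"
proof -
  have L0: "0 < L" using L by (smt (verit) divide_nonneg_nonneg zero_le_power2)
  obtain \<gamma> where \<gamma>: "0 < \<gamma>" "\<gamma> \<le> 1 / 8" "integral {0<..} (\<lambda>s. gap s * exp (\<gamma> * (s + gap s))) < L / 2"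
    using gap_exp_integral_near[of "L / 2"] L by auto
  define J where "J = integral {0<..} (\<lambda>s. gap s * exp (\<gamma> * (s + gap s)))"
  have J: "0 < L - 2 * J" using \<gamma> by (simp add: J_def)
  \<comment> \<open>The first entry makes the scaled tail rate at most \<gamma>; the second is the
    condition on J in \<open>shape_spread\<close>, solved for a^2. Both persist since a^2 only
    grows.\<close>
  define q where "q = max ((rate / \<gamma>)\<^sup>2) (2 * J * L / (L - 2 * J))"
  define a where "a = (\<lambda>n. sqrt (q + L * real n))"
  have q: "0 < q"
    using rate_pos \<gamma>(1) by (simp add: q_def less_max_iff_disj)
  have a2: "(a n)\<^sup>2 = q + L * real n" and a0: "0 < a n" for n
    using q L0 by (simp_all add: a_def add_pos_nonneg)
  have q_le: "q \<le> (a n)\<^sup>2" for n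
    unfolding a2 using L0 by simp
  have rate_a: "rate / a n \<le> \<gamma>" for n
  proof -
    have "(rate / \<gamma>)\<^sup>2 \<le> (a n)\<^sup>2"
      using q_le[of n] unfolding q_def by simp
    then have "rate / \<gamma> \<le> a n"
      by (rule power2_le_imp_le) (use a0[of n] in simp)
    then show ?thesis using \<gamma>(1) a0[of n] by (simp add: field_simps)
  qed
  have "shape (x / a n) \<le> dist_fun n (exp x)" for n x
  proof (induction n arbitrary: x)
    case 0
    show ?case
    proof (cases "x < 0")
      case True
      then have "x / a 0 \<le> 0" using a0[of 0] by (simp add: divide_le_0_iff)
      then show ?thesis using dist_fun_nonneg by (simp add: shape_eq_0)
    next
      case False
      then show ?thesis using shape_le_1 by (simp add: dist_fun_0)
    qed
  next
    case (Suc n)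
    interpret P: profile "\<lambda>x. shape (x / a n)" "\<lambda>x. shape' (x / a n) / a n" 0
      by (rule profile_shape[OF a0])
    have "P.drop x \<le> (shape' (x / a n) / a n)\<^sup>2 * J"
      unfolding J_def
    proof (rule P.drop_le)
      show "shape' ((x - s) / a n) / a n \<le> shape' (x / a n) / a n * exp (\<gamma> * s)" if "0 \<le> s" for x s
      proof -
        have "shape' ((x - s) / a n) \<le> shape' (x / a n) * exp (rate * (s / a n))"
          using shape'_tail[of "s / a n" "x / a n"] that a0[of n] by (simp add: diff_divide_distrib)
        also have "\<dots> \<le> shape' (x / a n) * exp (\<gamma> * s)"
          using mult_right_mono[OF rate_a that, of n] shape'_nonneg by (intro mult_left_mono) auto
        finally show ?thesis
          using a0[of n] by (simp add: divide_right_mono)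
      qed
    qed (use \<gamma> in auto)
    moreover have "shape (x / a (Suc n)) \<le> shape (x / a n) - (shape' (x / a n) / a n)\<^sup>2 * J / 2"
    proof (rule shape_spread[OF a0 _ L0])
      show "a (Suc n) = sqrt ((a n)\<^sup>2 + L)"
        unfolding a2 by (simp add: a_def algebra_simps)
      have "2 * J * L / (L - 2 * J) \<le> (a n)\<^sup>2"
        using q_le[of n] unfolding q_def by simp
      then show "2 * J * ((a n)\<^sup>2 + L) \<le> L * (a n)\<^sup>2"
        using J by (simp add: field_simps)
    qed
    moreover have "shape (x / a n) - P.drop x / 2 \<le> dist_fun (Suc n) (exp x)"
      using Suc.IH by (rule P.dist_fun_step_ge)
    ultimately show ?case by linarith
  qed
  from mean_ln_le_total[OF a0 this] show ?thesis
    using that[OF q] by (simp add: a_def)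
qed

end

section \<open>Lower bound and limit\<close>

definition parabola where "parabola B q x = (if x \<le> - B then 0 else (x + B)\<^sup>2 / q)" for B q x :: real
definition parabola' where "parabola' B q x = (if x \<le> - B then 0 else 2 * (x + B) / q)" for B q x :: real

lemma profile_parabola:
  assumes "0 < q"
  shows "profile (parabola B q) (parabola' B q) (- B)"
proof
  show "(parabola B q has_real_derivative parabola' B q x) (at x)" for x
    unfolding parabola_def parabola'_def
    by (rule DERIV_glue) (use assms in \<open>auto intro!: derivative_eq_intros\<close>)
  show "continuous_on UNIV (parabola' B q)"
    unfolding parabola'_def
    by (intro continuous_on_glue continuous_intros) (use assms in auto)
qed (use assms in \<open>auto simp: parabola_def parabola'_def\<close>)

text \<open>Without clipping the two sides differ by exactly 2 * s * t^2. The subtracted term,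
  linear in y, also covers the cases where a factor is clipped at 0.\<close>

lemma parabola_drop_pointwise:
  fixes y s t :: real
  assumes "0 \<le> y" "0 < s" "0 < t"
  shows "4 * (y\<^sup>2 * t - y * (s * t + t\<^sup>2 / 2)) \<le> (2 * max 0 (y - s)) * (y\<^sup>2 - (max 0 (y - t))\<^sup>2)"
proof -
  consider "y \<le> s" | "s < y" "y \<le> t" | "s < y" "t < y" by linarith
  then show ?thesis
  proof cases
    case 1
    have "y * (t * (y - s - t / 2)) \<le> 0"
      using 1 assms by (intro mult_nonneg_nonpos) auto
    moreover have "max 0 (y - s) = 0" using 1 by simp
    ultimately show ?thesis by (simp add: power2_eq_square algebra_simps)
  next
    case 2
    have "0 \<le> y * ((y - t)\<^sup>2 + s * (2 * t - y))"
      using 2 assms by (intro mult_nonneg_nonneg add_nonneg_nonneg) auto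
    moreover have "max 0 (y - s) = y - s" "max 0 (y - t) = 0" using 2 by simp_all
    ultimately show ?thesis by (simp add: power2_eq_square algebra_simps)
  next
    case 3
    have "0 \<le> s * t\<^sup>2" using assms by simp
    moreover have "max 0 (y - s) = y - s" "max 0 (y - t) = y - t" using 3 by simp_all
    ultimately show ?thesis by (simp add: power2_eq_square algebra_simps)
  qed
qed

text \<open>The growth per level of the squared front position, twice the integral of
  \<open>gap\<close>.\<close>

definition speed :: real where "speed = pi\<^sup>2 / 3"

lemma gap_has_integral_speed: "(gap has_integral speed / 2) {0<..}"
  using gap_has_integral by (simp add: speed_def)

definition gap_moment :: real where
  "gap_moment = integral {0<..} (\<lambda>s. s * gap s + (gap s)\<^sup>2 / 2)"

lemma gap_moment_nonneg: "0 \<le> gap_moment"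
  unfolding gap_moment_def
proof (rule integral_nonneg[OF gap_moment_integrable])
  show "0 \<le> s * gap s + (gap s)\<^sup>2 / 2" if "s \<in> {0<..}" for s
    using gap_pos[of s] that by simp
qed

text \<open>Integrating the pointwise bound gives pi^2 / 6 times the squared density 2 * (x + B) /
  q, up to an error linear in x + B.\<close>

lemma parabola_drop_ge:
  assumes "0 < q" "0 \<le> x + B"
  shows "4 / q\<^sup>2 * ((x + B)\<^sup>2 * (speed / 2) - (x + B) * gap_moment) \<le> profile.drop (parabola B q) (parabola' B q) x"
proof -
  interpret P: profile "parabola B q" "parabola' B q" "- B"
    by (rule profile_parabola[OF assms(1)])
  define y where "y = x + B"
  have "((\<lambda>s. 4 / q\<^sup>2 * (y\<^sup>2 * gap s - y * (s * gap s + (gap s)\<^sup>2 / 2))) has_integral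
    4 / q\<^sup>2 * (y\<^sup>2 * (speed / 2) - y * gap_moment)) {0<..}"
    unfolding gap_moment_def
    by (intro has_integral_mult_right has_integral_diff gap_has_integral_speed integrable_integral gap_moment_integrable)
  then show ?thesis
    unfolding y_def[symmetric]
  proof (rule has_integral_le[OF _ P.drop_has_integral])
    fix s :: real assume s: "s \<in> {0<..}"
    define t where "t = gap s"
    have V: "parabola B q (x - w) = (max 0 (y - w))\<^sup>2 / q" "parabola' B q (x - w) = 2 * max 0 (y - w) / q" for w
      by (auto simp: parabola_def parabola'_def y_def max_def algebra_simps)
    have "4 / q\<^sup>2 * (y\<^sup>2 * t - y * (s * t + t\<^sup>2 / 2)) = 4 * (y\<^sup>2 * t - y * (s * t + t\<^sup>2 / 2)) / q\<^sup>2"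
      by simp
    also have "\<dots> \<le> (2 * max 0 (y - s)) * (y\<^sup>2 - (max 0 (y - t))\<^sup>2) / q\<^sup>2"
      using assms s gap_pos[of s] by (intro divide_right_mono parabola_drop_pointwise) (auto simp: y_def t_def)
    also have "\<dots> = parabola' B q (x - s) * (parabola B q x - parabola B q (x - t))"
      using V[of s] V[of t] V[of 0] assms by (simp add: y_def[symmetric] power2_eq_square diff_divide_distrib[symmetric])
    finally show "4 / q\<^sup>2 * (y\<^sup>2 * gap s - y * (s * gap s + (gap s)\<^sup>2 / 2))
        \<le> parabola' B q (x - s) * (parabola B q x - parabola B q (x - gap s))"
      by (simp add: t_def)
  qed
qed

lemma speed_ge_1: "1 \<le> speed"
proof -
  have "3\<^sup>2 \<le> pi\<^sup>2"
    using pi_gt3 by (intro power_mono) auto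
  then show ?thesis by (simp add: speed_def)
qed

text \<open>Collects the two errors of one step, both of the form y / q^2: half the linear term of
  \<open>parabola_drop_ge\<close>, and the excess of the parabola over 1.\<close>

definition shift_const :: real where
  "shift_const = 2 * gap_moment + speed\<^sup>2 / 2"

definition scale_sq :: "nat \<Rightarrow> real" where
  "scale_sq n = speed * (real n + 1)"

text \<open>The start makes the first parabola equal to 1 at x = 0. Each level adds
  \<open>shift_const / scale_sq n\<close>, and these increments sum to a harmonic number.\<close>

definition shift :: "nat \<Rightarrow> real" where
  "shift n = sqrt speed + shift_const / speed * harm n"

lemma dist_fun_le_parabola: "dist_fun n (exp x) \<le> parabola (shift n) (scale_sq n) x"
proof (induction n arbitrary: x)
  case 0
  show ?case
  proof (cases "x < 0")
    case True
    then show ?thesis using speed_ge_1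
      by (simp add: dist_fun_eq_0 parabola_def scale_sq_def)
  next
    case False
    have "sqrt speed ^ 2 \<le> (x + sqrt speed)\<^sup>2"
      using False speed_ge_1 by (intro power_mono) auto
    moreover have "0 < sqrt speed" using speed_ge_1 by simp
    then have "\<not> x \<le> - sqrt speed" using False by linarith
    ultimately have "1 \<le> parabola (shift 0) (scale_sq 0) x"
      using False speed_ge_1 by (auto simp: parabola_def shift_def scale_sq_def harm_expand field_simps)
    then show ?thesis
      using dist_fun_le_1[of 0 "exp x"] by linarith
  qed
next
  case (Suc n)
  define q q' B B' where "q = scale_sq n" and "q' = scale_sq (Suc n)" and "B = shift n" and "B' = shift (Suc n)"
  have q: "speed \<le> q"
    using mult_left_mono[of 1 "real n + 1" speed] speed_ge_1 by (simp add: q_def scale_sq_def)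
  have q0: "0 < q" using q speed_ge_1 by linarith
  have q': "q' = q + speed"
    by (simp add: q_def q'_def scale_sq_def algebra_simps)
  have sc: "0 \<le> shift_const"
    using gap_moment_nonneg by (simp add: shift_const_def)
  have B': "B' = B + shift_const / q"
    by (simp add: B_def B'_def shift_def q_def scale_sq_def harm_Suc distrib_left inverse_eq_divide add.commute)
  have "1 \<le> sqrt speed" using speed_ge_1 by simp
  moreover have "0 \<le> shift_const / speed * harm n"
    using sc harm_nonneg[of n] speed_ge_1 by (intro mult_nonneg_nonneg divide_nonneg_nonneg) auto
  ultimately have B: "1 \<le> B" unfolding B_def shift_def by linarith
  have BB': "B \<le> B'" using B' sc q0 by simp
  show ?case
    unfolding q'_def[symmetric] B'_def[symmetric]
  proof (cases "x < 0")
    case True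
    then show "dist_fun (Suc n) (exp x) \<le> parabola B' q' x"
      using q' q0 speed_ge_1 by (simp add: dist_fun_eq_0 parabola_def)
  next
    case x: False
    define y where "y = x + B"
    have y: "1 \<le> y" using x B by (simp add: y_def)
    have V': "parabola B' q' x = (y + shift_const / q)\<^sup>2 / q'"
      using x B BB' by (simp add: parabola_def y_def B' algebra_simps)
    show "dist_fun (Suc n) (exp x) \<le> parabola B' q' x"
    \<comment> \<open>If the new parabola has reached 1 there is nothing to prove. Otherwise y^2 <
      q', so the old one exceeds 1 by at most speed / q.\<close>
    proof (cases "1 \<le> parabola B' q' x")
      case True
      then show ?thesis using dist_fun_le_1[of "Suc n" "exp x"] by linarith
    next
      case False
      interpret P: profile "parabola B q" "parabola' B q" "- B"
        by (rule profile_parabola[OF q0])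
      have V: "parabola B q x = y\<^sup>2 / q"
        using x B by (simp add: parabola_def y_def)
      have "y\<^sup>2 \<le> (y + shift_const / q)\<^sup>2"
        using y sc q0 by (intro power_mono) auto
      also have "\<dots> < q'"
        using False q' q0 speed_ge_1 pos_divide_less_eq[of q' "(y + shift_const / q)\<^sup>2" 1]
        unfolding V' by simp
      finally have "y\<^sup>2 / q \<le> (q + speed) / q"
        using q0 by (intro divide_right_mono) (auto simp: q')
      then have "y\<^sup>2 / q - 1 \<le> speed / q"
        using q0 by (simp add: add_divide_distrib)
      then have "max 0 (parabola B q x - 1) \<le> speed / q"
        using q0 speed_ge_1 by (simp add: V)
      then have "(max 0 (parabola B q x - 1))\<^sup>2 \<le> (speed / q)\<^sup>2"
        by (intro power_mono) auto
      \<comment> \<open>Since y >= 1, the excess is bounded by a term linear in y, the form that the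
        shift absorbs.\<close>
      also have "\<dots> \<le> speed\<^sup>2 * y / q\<^sup>2"
        using y mult_left_mono[of 1 y "speed\<^sup>2"] by (simp add: power_divide divide_right_mono)
      finally have excess: "(max 0 (parabola B q x - 1))\<^sup>2 \<le> speed\<^sup>2 * y / q\<^sup>2" .
      have "dist_fun (Suc n) (exp x) \<le> parabola B q x - P.drop x / 2 + (max 0 (parabola B q x - 1))\<^sup>2 / 2"
        using Suc.IH by (intro P.dist_fun_step_le) (simp add: q_def B_def)
      also have "\<dots> \<le> y\<^sup>2 / q - 4 / q\<^sup>2 * (y\<^sup>2 * (speed / 2) - y * gap_moment) / 2 + speed\<^sup>2 * y / q\<^sup>2 / 2"
        using parabola_drop_ge[OF q0, of x B] excess y by (simp add: V y_def[symmetric])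
      also have "\<dots> = y\<^sup>2 * ((q - speed) / q\<^sup>2) + y * (shift_const / q\<^sup>2)"
        using q0 by (simp add: shift_const_def field_simps power2_eq_square)
      \<comment> \<open>The quadratic part uses (q - speed) * (q + speed) <= q^2, the linear part q'
        <= 2 * q. The result is the new parabola without the square of the shift increment.\<close>
      also have "\<dots> \<le> y\<^sup>2 * (1 / q') + y * (2 * (shift_const / q) / q')"
      proof (intro add_mono mult_left_mono)
        show "(q - speed) / q\<^sup>2 \<le> 1 / q'"
          using q0 speed_ge_1 by (simp add: q' field_simps power2_eq_square)
        have "shift_const * q' \<le> shift_const * (2 * q)"
          using sc q q' by (intro mult_left_mono) auto
        then have "shift_const * q' / (q\<^sup>2 * q') \<le> shift_const * (2 * q) / (q\<^sup>2 * q')"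
          using q0 q' speed_ge_1 by (intro divide_right_mono) auto
        then show "shift_const / q\<^sup>2 \<le> 2 * (shift_const / q) / q'"
          using q0 q' speed_ge_1 by (simp add: power2_eq_square mult_ac)
      qed (use y in auto)
      also have "\<dots> \<le> (y + shift_const / q)\<^sup>2 / q'"
      proof -
        have "y\<^sup>2 + y * (2 * (shift_const / q)) \<le> (y + shift_const / q)\<^sup>2"
          unfolding power2_sum by (simp add: mult_ac)
        then have "(y\<^sup>2 + y * (2 * (shift_const / q))) / q' \<le> (y + shift_const / q)\<^sup>2 / q'"
          using q0 q' speed_ge_1 by (intro divide_right_mono) auto
        then show ?thesis by (simp add: add_divide_distrib)
      qed
      finally show ?thesis by (simp add: V')
    qed
  qed
qed

text \<open>Integrating 1 - (x + B)^2 / a^2 up to a - B, where the parabola reaches 1, gives 2 * a /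
  3 - B + B^3 / (3 * a^2). For B > a the claimed bound is negative.\<close>

lemma mean_ln_lower: "2 / 3 * sqrt (scale_sq n) - shift n \<le> mean n (\<lambda>i. ln (real i))"
proof (cases "shift n \<le> sqrt (scale_sq n)")
  case False
  have "0 \<le> mean n (\<lambda>i. ln (real i))"
    by (rule mean_nonneg) simp
  moreover have "0 \<le> sqrt (scale_sq n)"
    using speed_ge_1 by (simp add: scale_sq_def)
  ultimately show ?thesis using False by linarith
next
  case True
  define a B where "a = sqrt (scale_sq n)" and "B = shift n"
  have q0: "0 < scale_sq n"
    using speed_ge_1 by (simp add: scale_sq_def)
  have a: "0 < a" "scale_sq n = a\<^sup>2" using q0 by (simp_all add: a_def)
  have B: "0 < B"
  proof -
    have "0 \<le> shift_const / speed * harm n"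
      using gap_moment_nonneg harm_nonneg[of n]
      using speed_ge_1 by (intro mult_nonneg_nonneg divide_nonneg_nonneg) (auto simp: shift_const_def)
    moreover have "0 < sqrt speed" using speed_ge_1 by simp
    ultimately show ?thesis unfolding B_def shift_def by linarith
  qed
  define H where "H = (\<lambda>x. x - (x + B) ^ 3 / (3 * a\<^sup>2))"
  have "H (a - B) - H 0 \<le> mean n (\<lambda>i. ln (real i))"
  proof (rule mean_ln_ge)
    show L: "0 \<le> a - B" using True by (simp add: a_def B_def)
    show "((\<lambda>x. 1 - (x + B)\<^sup>2 / a\<^sup>2) has_integral H (a - B) - H 0) {0..a - B}"
    proof (rule fundamental_theorem_of_calculus[OF L])
      fix x
      have "(H has_real_derivative 1 - (x + B)\<^sup>2 / a\<^sup>2) (at x)"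
        unfolding H_def using a(1)
        by (auto intro!: derivative_eq_intros simp: field_simps power2_eq_square)
      then show "(H has_vector_derivative 1 - (x + B)\<^sup>2 / a\<^sup>2) (at x within {0..a - B})"
        by (auto simp: has_real_derivative_iff_has_vector_derivative intro: has_vector_derivative_at_within)
    qed
    show "1 - (x + B)\<^sup>2 / a\<^sup>2 \<le> 1 - dist_fun n (exp x)" if "x \<in> {0..a - B}" for x
      using dist_fun_le_parabola[of n x] that B by (simp add: parabola_def a(2) B_def)
  qed
  moreover have "H (a - B) - H 0 = 2 / 3 * a - B + B ^ 3 / (3 * a\<^sup>2)"
    using a(1) by (simp add: H_def power3_eq_cube power2_eq_square field_simps)
  moreover have "0 \<le> B ^ 3 / (3 * a\<^sup>2)"
    using B by simp
  ultimately show ?thesis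
    by (simp add: a_def B_def)
qed

section \<open>Passage to the limit\<close>

lemma harm_over_sqrt: "(\<lambda>n. harm n / sqrt (real n + 1)) \<longlonglongrightarrow> (0::real)"
proof -
  have "(\<lambda>n. (harm n - ln (real n)) * (1 / sqrt (real n + 1)) + ln (real n) / sqrt (real n + 1))
      \<longlonglongrightarrow> euler_mascheroni * 0 + 0"
    by (intro tendsto_add tendsto_mult euler_mascheroni_LIMSEQ; real_asymp)
  then show ?thesis by (simp add: diff_divide_distrib)
qed

lemma limit_const: "2 / 3 * sqrt speed = 2 * pi / (3 * sqrt 3)"
  by (simp add: speed_def real_sqrt_divide)

lemma mean_ln_limit: "(\<lambda>n. mean n (\<lambda>i. ln (real i)) / sqrt (real n + 1)) \<longlonglongrightarrow> 2 * pi / (3 * sqrt 3)"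
proof (rule order_tendstoI)
  fix z assume z: "z < 2 * pi / (3 * sqrt 3)"
  have "(\<lambda>n. 2 / 3 * sqrt speed - (sqrt speed * (1 / sqrt (real n + 1)) + shift_const / speed * (harm n / sqrt (real n + 1))))
      \<longlonglongrightarrow> 2 / 3 * sqrt speed - (sqrt speed * 0 + shift_const / speed * 0)"
    by (intro tendsto_intros harm_over_sqrt; real_asymp)
  then have "eventually (\<lambda>n. z < 2 / 3 * sqrt speed - (sqrt speed * (1 / sqrt (real n + 1)) + shift_const / speed * (harm n / sqrt (real n + 1)))) sequentially"
    by (rule order_tendstoD(1)) (use z limit_const in simp)
  then show "eventually (\<lambda>n. z < mean n (\<lambda>i. ln (real i)) / sqrt (real n + 1)) sequentially"
  proof eventually_elim
    case (elim n)
    have "2 / 3 * sqrt speed - (sqrt speed * (1 / sqrt (real n + 1)) + shift_const / speed * (harm n / sqrt (real n + 1)))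
      = (2 / 3 * sqrt (scale_sq n) - shift n) / sqrt (real n + 1)"
      by (simp add: scale_sq_def shift_def real_sqrt_mult diff_divide_distrib add_divide_distrib)
    also have "\<dots> \<le> mean n (\<lambda>i. ln (real i)) / sqrt (real n + 1)"
      by (intro divide_right_mono mean_ln_lower) simp
    finally show ?case using elim by linarith
  qed
next
  fix z assume z: "2 * pi / (3 * sqrt 3) < z"
  \<comment> \<open>The limiting upper bound with squared front growth
    \<open>speed + \<delta>\<close> and switch point u0 = 1 - \<delta>. One parameter removes both
    losses, and F is continuous at 0.\<close>
  define F where "F = (\<lambda>\<delta>. sqrt (speed + \<delta>) * ((1 - \<delta>) - (1 - \<delta>) ^ 3 / 3 + (1 - (1 - \<delta>)\<^sup>2)\<^sup>2 / (2 * (1 - \<delta>))))"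
  have "isCont F 0"
    unfolding F_def by (intro continuous_intros) auto
  then have "F \<midarrow>0\<rightarrow> F 0"
    by (simp add: isCont_def)
  then have "(F \<longlongrightarrow> F 0) (at_right 0)"
    by (rule tendsto_within_subset) simp
  moreover have "F 0 = 2 * pi / (3 * sqrt 3)"
    unfolding limit_const[symmetric] by (simp add: F_def)
  ultimately have "eventually (\<lambda>\<delta>. F \<delta> < z) (at_right 0)"
    using z by (intro order_tendstoD(2)) auto
  moreover have "eventually (\<lambda>\<delta>::real. \<delta> < 1) (at_right 0)" "eventually (\<lambda>\<delta>::real. 0 < \<delta>) (at_right 0)"
    by (auto simp: eventually_at_right_less intro: eventually_at_right_real[of 0 1, THEN eventually_mono])
  ultimately have "eventually (\<lambda>\<delta>. F \<delta> < z \<and> \<delta> < 1 \<and> 0 < \<delta>) (at_right 0)"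
    by eventually_elim auto
  then obtain \<delta> where \<delta>: "F \<delta> < z" "\<delta> < 1" "0 < \<delta>"
    using eventually_happens by force
  interpret upper_shape "1 - \<delta>"
    by standard (use \<delta> in auto)
  obtain q where q: "0 < q" "\<And>n. mean n (\<lambda>i. ln (real i)) \<le> sqrt (q + (speed + \<delta>) * real n) * total"
    using mean_ln_upper[of "speed + \<delta>"] \<delta> by (auto simp: speed_def)
  define L where "L = speed + \<delta>"
  have L: "0 < L" using \<delta> speed_ge_1 by (simp add: L_def)
  have "(\<lambda>n. sqrt ((q + L * real n) / (real n + 1)) * total) \<longlonglongrightarrow> sqrt L * total"
    using L by (intro tendsto_intros; real_asymp)
  moreover have "sqrt L * total < z"
    using \<delta>(1) by (simp add: F_def L_def total_def)
  ultimately have "eventually (\<lambda>n. sqrt ((q + L * real n) / (real n + 1)) * total < z) sequentially"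
    by (rule order_tendstoD(2))
  then show "eventually (\<lambda>n. mean n (\<lambda>i. ln (real i)) / sqrt (real n + 1) < z) sequentially"
  proof eventually_elim
    case (elim n)
    have "mean n (\<lambda>i. ln (real i)) / sqrt (real n + 1) \<le> sqrt (q + L * real n) * total / sqrt (real n + 1)"
      using q(2)[of n] by (intro divide_right_mono) (auto simp: L_def)
    also have "\<dots> = sqrt ((q + L * real n) / (real n + 1)) * total"
      by (simp add: real_sqrt_divide)
    finally show ?case using elim by linarith
  qed
qed

theorem corollary1:
  fixes M :: "nat \<Rightarrow> 'a measure" and p :: real
    and \<eta> :: "nat \<Rightarrow> bool list \<Rightarrow> 'a \<Rightarrow> int"
  assumes signs: "\<And>N. N \<ge> 1 \<Longrightarrow> random_tree_signs (M N) p N (\<eta> N)"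
    and p: "p = 1 / 2"
  shows "(\<lambda>N. 1 / sqrt (real N) *
           prob_space.expectation (M N) (\<lambda>\<omega>. ln (real (root_value N (\<lambda>v. \<eta> N v \<omega>)))))
         \<longlonglongrightarrow> 2 * pi / (3 * sqrt 3)"
proof -
  \<comment> \<open>Depth N = Suc n corresponds to \<open>mean n\<close>. The index N = 0, where
    nothing is assumed, does not affect the limit.\<close>
  have "prob_space.expectation (M (Suc n)) (\<lambda>\<omega>. ln (real (root_value (Suc n) (\<lambda>v. \<eta> (Suc n) v \<omega>)))) =
      mean n (\<lambda>i. ln (real i))" for n
  proof -
    interpret random_tree_signs "M (Suc n)" p "Suc n" "\<eta> (Suc n)"
      by (rule signs) simp
    show ?thesis
      unfolding root_value_def by (rule expectation_node[OF p]) simp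
  qed
  then have "(\<lambda>n. 1 / sqrt (real (Suc n)) * prob_space.expectation (M (Suc n))
      (\<lambda>\<omega>. ln (real (root_value (Suc n) (\<lambda>v. \<eta> (Suc n) v \<omega>))))) =
      (\<lambda>n. mean n (\<lambda>i. ln (real i)) / sqrt (real n + 1))"
    by (simp add: add.commute)
  with mean_ln_limit show ?thesis
    by (subst filterlim_sequentially_Suc[symmetric]) simp
qed

end
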